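(* Every odd-$C_5^{+}$-free graph $H$ satisfies $\chi'(H)=\lceil\chi_f'(H)\rceil$.
   Context: Graphs are finite, undirected and loopless, and may have multiple edges (so $H$ is a multigraph in general). A subdivision of a graph $K$ is a graph obtained by replacing every edge $e$ of $K$ by a path $P_e$ of non-zero length joining the ends of $e$, the paths $P_e$ being pairwise disjoint except possibly at their ends; it is a totally odd subdivision if every $P_e$ has odd length (number of edges). $C_5^{+}$ is the graph with vertex set $\{1,2,3,4,5\}$ and edge set $\{12,23,34,45,15,25\}$. A graph is odd-$C_5^{+}$-free if no subgraph of it (not necessarily induced) is isomorphic to a totally odd subdivision of $C_5^{+}$. A matching of $H$ is a set of pairwise non-incident edges. The chromatic index $\chi'(H)$ is the least $k$ such that $E(H)$ can be covered by $k$ matchings. The fractional chromatic index is $$\chi'_f(H)=\min\Big\{\sum_{M}y_M:\ y\in\mathbb{Q}_+^{\mathcal{M}(H)},\ \sum_{M\ni e}y_M\ge 1\ \ \forall e\in E(H)\Big\},$$ where $\mathcal{M}(H)$ is the set of matchings of $H$. (Equivalently, $\chi'(H)$ and $\chi'_f(H)$ are the chromatic and fractional chromatic numbers of the line graph of $H$.) *)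

theory Defs
  imports Complex_Main
begin

record ('v, 'e) mgraph =
  verts :: "'v set"
  edges :: "'e set"
  ends :: "'e \<Rightarrow> 'v set"

text \<open>Edges are named objects, so parallel edges are distinct edges with the same set of ends;
  an edge has exactly two ends, which rules out loops.\<close>

locale multigraph =
  fixes G :: "('v, 'e) mgraph"
  assumes finite_verts: "finite (verts G)"
    and finite_edges: "finite (edges G)"
    and ends_subset: "e \<in> edges G \<Longrightarrow> ends G e \<subseteq> verts G"
    and card_ends: "e \<in> edges G \<Longrightarrow> card (ends G e) = 2"

definition subgraph :: "('v, 'e) mgraph \<Rightarrow> ('v, 'e) mgraph \<Rightarrow> bool" where
  "subgraph S G \<longleftrightarrow> multigraph S \<and> verts S \<subseteq> verts G \<and> edges S \<subseteq> edges G \<and>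
    (\<forall>e\<in>edges S. ends S e = ends G e)"

definition is_path :: "('v, 'e) mgraph \<Rightarrow> 'v list \<Rightarrow> 'e list \<Rightarrow> bool" where
  "is_path G vs es \<longleftrightarrow> length vs = Suc (length es) \<and> distinct vs \<and>
    set vs \<subseteq> verts G \<and> set es \<subseteq> edges G \<and>
    (\<forall>i<length es. ends G (es ! i) = {vs ! i, vs ! Suc i})"

text \<open>\<open>subdivision_via K S f P Q\<close>: \<open>S\<close> arises from \<open>K\<close> by replacing every edge \<open>e\<close> by the path
  with vertex sequence \<open>P e\<close> and edge sequence \<open>Q e\<close>. The injection \<open>f\<close> names the vertices of
  \<open>K\<close> inside \<open>S\<close>, so \<open>S\<close> is described up to isomorphism. Vertices common to two paths are ends
  of both, inner vertices are new, and the paths are also edge-disjoint, which is not implied by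
  the former when \<open>K\<close> has parallel edges.\<close>

definition subdivision_via ::
  "('a, 'b) mgraph \<Rightarrow> ('v, 'e) mgraph \<Rightarrow> ('a \<Rightarrow> 'v) \<Rightarrow> ('b \<Rightarrow> 'v list) \<Rightarrow> ('b \<Rightarrow> 'e list) \<Rightarrow> bool"
where
  "subdivision_via K S f P Q \<longleftrightarrow>
    inj_on f (verts K) \<and>
    (\<forall>e\<in>edges K. is_path S (P e) (Q e) \<and> Q e \<noteq> [] \<and>
       {hd (P e), last (P e)} = f ` ends K e \<and>
       set (P e) \<inter> f ` verts K = f ` ends K e) \<and>
    (\<forall>d\<in>edges K. \<forall>e\<in>edges K. d \<noteq> e \<longrightarrow>
       set (P d) \<inter> set (P e) \<subseteq> f ` ends K d \<inter> f ` ends K e \<and>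
       set (Q d) \<inter> set (Q e) = {}) \<and>
    verts S = f ` verts K \<union> (\<Union>e\<in>edges K. set (P e)) \<and>
    edges S = (\<Union>e\<in>edges K. set (Q e))"

definition totally_odd_subdivision :: "('a, 'b) mgraph \<Rightarrow> ('v, 'e) mgraph \<Rightarrow> bool" where
  "totally_odd_subdivision K S \<longleftrightarrow>
    (\<exists>f P Q. subdivision_via K S f P Q \<and> (\<forall>e\<in>edges K. odd (length (Q e))))"

definition odd_free :: "('a, 'b) mgraph \<Rightarrow> ('v, 'e) mgraph \<Rightarrow> bool" where
  "odd_free K G \<longleftrightarrow> \<not> (\<exists>S. subgraph S G \<and> totally_odd_subdivision K S)"

definition C5_plus :: "(nat, nat set) mgraph" where
  "C5_plus = \<lparr>verts = {1, 2, 3, 4, 5},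
     edges = {{1, 2}, {2, 3}, {3, 4}, {4, 5}, {1, 5}, {2, 5}},
     ends = (\<lambda>e. e)\<rparr>"

definition matchings :: "('v, 'e) mgraph \<Rightarrow> 'e set set" where
  "matchings G = {M. M \<subseteq> edges G \<and>
     (\<forall>d\<in>M. \<forall>e\<in>M. d \<noteq> e \<longrightarrow> ends G d \<inter> ends G e = {})}"

definition chromatic_index :: "('v, 'e) mgraph \<Rightarrow> nat" where
  "chromatic_index G =
    (LEAST k. \<exists>M. (\<forall>i<k. M i \<in> matchings G) \<and> edges G \<subseteq> (\<Union>i<k. M i))"

definition fractional_edge_cover :: "('v, 'e) mgraph \<Rightarrow> ('e set \<Rightarrow> rat) \<Rightarrow> bool" where
  "fractional_edge_cover G y \<longleftrightarrow> (\<forall>M\<in>matchings G. 0 \<le> y M) \<and>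
    (\<forall>e\<in>edges G. 1 \<le> (\<Sum>M | M \<in> matchings G \<and> e \<in> M. y M))"

text \<open>The minimum of this linear program is attained for finite graphs, so it is the infimum below.
  The infimum is taken in the reals because the rationals are not conditionally complete.\<close>

definition fractional_chromatic_index :: "('v, 'e) mgraph \<Rightarrow> real" where
  "fractional_chromatic_index G =
    Inf {real_of_rat (\<Sum>M\<in>matchings G. y M) | y. fractional_edge_cover G y}"

end

theory Submission
  imports Defs
begin

text \<open>Let \<open>k\<close> be the rounded-up fractional chromatic index. Weak duality gives that all degrees are at
  most \<open>k\<close> and that every odd vertex set \<open>U\<close> spans at most \<open>k (|U| - 1) / 2\<close> edges. Suppose all edges
  but \<open>e = xy\<close> can be coloured with \<open>k\<close> colours, and the whole graph cannot. Colours \<open>a\<close> missing at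
  \<open>x\<close> and \<open>b\<close> missing at \<open>y\<close> yield a Kempe chain between \<open>x\<close> and \<open>y\<close> that closes up with \<open>e\<close> to an odd
  cycle, with vertex set \<open>U\<close>. As the graph is odd-\<open>C5_plus\<close>-free, the only odd ears of this cycle are
  edges parallel to its edges. Hence Kempe chains that leave \<open>U\<close> cannot return, and this forces every colour
  other than \<open>a\<close> and \<open>b\<close> to match all but at most one vertex of \<open>U\<close> inside \<open>U\<close>. Together with the cycle
  this makes more than \<open>k (|U| - 1) / 2\<close> edges within \<open>U\<close>, a contradiction.\<close>

section \<open>Paths and odd theta graphs\<close>

lemma is_path_ends_subset:
  assumes "is_path G vs es" "d \<in> set es"
  shows "ends G d \<subseteq> set vs"
proof -
  obtain i where "i < length es" "es ! i = d"
    using assms(2) by (auto simp: in_set_conv_nth)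
  then show ?thesis using assms(1) by (auto simp: is_path_def)
qed

lemma is_path_tl:
  assumes "is_path G (v # vs) (d # es)"
  shows "is_path G vs es"
  unfolding is_path_def
proof (intro conjI allI impI)
  fix i assume "i < length es"
  then have "Suc i < length (d # es)" by simp
  then have "ends G ((d # es) ! Suc i) = {(v # vs) ! Suc i, (v # vs) ! Suc (Suc i)}"
    using assms unfolding is_path_def by blast
  then show "ends G (es ! i) = {vs ! i, vs ! Suc i}" by simp
qed (use assms in \<open>auto simp: is_path_def\<close>)

lemma is_path_hd_edge:
  assumes "is_path G (v # w # vs) (d # es)"
  shows "is_path G [v, w] [d]"
  using assms by (auto simp: is_path_def)

lemma is_path_distinct_edges:
  assumes "is_path G vs es"
  shows "distinct es"
  unfolding distinct_conv_nth
proof (intro allI impI)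
  fix i j assume *: "i < length es" "j < length es" "i \<noteq> j"
  show "es ! i \<noteq> es ! j"
  proof
    assume "es ! i = es ! j"
    then have "{vs ! i, vs ! Suc i} = {vs ! j, vs ! Suc j}"
      using assms * by (metis is_path_def)
    then show False
      using assms * by (auto simp: is_path_def doubleton_eq_iff nth_eq_iff_index_eq)
  qed
qed

lemma is_path_subgraph:
  assumes "is_path G vs es" "set vs \<subseteq> verts S" "set es \<subseteq> edges S" "ends S = ends G"
  shows "is_path S vs es"
  using assms by (auto simp: is_path_def)

text \<open>A totally odd subdivision of \<open>C5_plus\<close> is the same as three internally disjoint paths between
  two vertices (the images of 2 and 5), one of even length and two of odd length, the latter not
  both of length 1.\<close>

lemma (in multigraph) odd_theta_not_odd_free:
  assumes path1: "is_path G P1 Q1" and path2: "is_path G P2 Q2" and path3: "is_path G P3 Q3"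
    and hd: "hd P1 = a" "hd P2 = a" "hd P3 = a"
    and last: "last P1 = b" "last P2 = b" "last P3 = b"
    and "even (length Q1)" "Q1 \<noteq> []" "odd (length Q2)" "odd (length Q3)" "3 \<le> length Q3"
    and disj: "set P1 \<inter> set P2 \<subseteq> {a, b}" "set P1 \<inter> set P3 \<subseteq> {a, b}" "set P2 \<inter> set P3 \<subseteq> {a, b}"
    and disjQ: "set Q1 \<inter> set Q2 = {}" "set Q1 \<inter> set Q3 = {}" "set Q2 \<inter> set Q3 = {}"
  shows "\<not> odd_free C5_plus G"
proof -
  have len: "length P1 = Suc (length Q1)" "length P2 = Suc (length Q2)" "length P3 = Suc (length Q3)"
    using path1 path2 path3 by (simp_all add: is_path_def)
  \<comment> \<open>The even path is cut after its first edge: this edge serves as the path for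
    \<open>{1,2}\<close>, and the odd rest as the path for \<open>{1,5}\<close>.\<close>
  obtain d1 Q1' where Q1: "Q1 = d1 # Q1'" "Q1' \<noteq> []" "odd (length Q1')"
    using assms(10,11) by (cases Q1) fastforce+
  obtain p R1 where P1: "P1 = a # p # R1" "R1 \<noteq> []" "last R1 = b"
    using len(1) Q1 hd(1) last(1)
    by (cases P1; cases "tl P1"; cases "tl (tl P1)") auto
  \<comment> \<open>Length at least 3 leaves room for the vertices 3 and 4: two single edges for
    \<open>{2,3}\<close> and \<open>{3,4}\<close>, and an odd rest for \<open>{4,5}\<close>. The
    path \<open>P2\<close> becomes the path for \<open>{2,5}\<close>.\<close>
  obtain d2 d3 Q3' where Q3: "Q3 = d2 # d3 # Q3'" "Q3' \<noteq> []" "odd (length Q3')"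
    using assms(13,14) by (cases Q3; cases "tl Q3"; cases "tl (tl Q3)") auto
  obtain q r R3 where P3: "P3 = a # q # r # R3" "R3 \<noteq> []" "last R3 = b"
    using len(3) Q3 hd(3) last(3)
    by (cases P3; cases "tl P3"; cases "tl (tl P3)"; cases "tl (tl (tl P3))") auto
  have dist: "distinct P1" "distinct P2" "distinct P3" "distinct Q1" "distinct Q3"
    using path1 path2 path3 is_path_distinct_edges by (auto simp: is_path_def)
  have bR: "b \<in> set R1" "b \<in> set R3" using P1 P3 last_in_set by metis+
  have P2: "a \<in> set P2" "b \<in> set P2"
    using len(2) hd(2) last(2) by (metis hd_in_set last_in_set length_0_conv nat.distinct(1))+
  define S where "S = \<lparr>verts = set P1 \<union> set P2 \<union> set P3, edges = set Q1 \<union> set Q2 \<union> set Q3,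
    ends = ends G\<rparr>"
  have S[simp]: "verts S = set P1 \<union> set P2 \<union> set P3" "edges S = set Q1 \<union> set Q2 \<union> set Q3"
    "ends S = ends G" by (simp_all add: S_def)
  have sub: "subgraph S G"
    unfolding subgraph_def
  proof (intro conjI)
    have Q: "edges S \<subseteq> edges G" using path1 path2 path3 by (auto simp: is_path_def)
    then show "edges S \<subseteq> edges G" .
    show "multigraph S"
    proof
      fix e assume "e \<in> edges S"
      then show "ends S e \<subseteq> verts S"
        using is_path_ends_subset[OF path1] is_path_ends_subset[OF path2]
          is_path_ends_subset[OF path3] by (simp, blast)
      show "card (ends S e) = 2" using \<open>e \<in> edges S\<close> Q card_ends by auto
    qed auto
    show "verts S \<subseteq> verts G" using path1 path2 path3 by (auto simp: is_path_def)
  qed auto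
  define f :: "nat \<Rightarrow> 'v" where
    "f = (\<lambda>i. if i = 1 then p else if i = 2 then a else if i = 3 then q else if i = 4 then r else b)"
  have f[simp]: "f 1 = p" "f (Suc 0) = p" "f 2 = a" "f 3 = q" "f 4 = r" "f 5 = b"
    by (simp_all add: f_def)
  define P where "P = (\<lambda>e::nat set. if e = {1,2} then [a, p] else if e = {2,3} then [a, q]
    else if e = {3,4} then [q, r] else if e = {4,5} then r # R3 else if e = {1,5} then p # R1 else P2)"
  define Q where "Q = (\<lambda>e::nat set. if e = {1,2} then [d1] else if e = {2,3} then [d2]
    else if e = {3,4} then [d3] else if e = {4,5} then Q3' else if e = {1,5} then Q1' else Q2)"
  \<comment> \<open>The variants with \<open>Suc 0\<close> match the form into which the simplifier
    rewrites \<open>1\<close>.\<close>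
  have P[simp]: "P {1,2} = [a, p]" "P {2,3} = [a, q]" "P {3,4} = [q, r]" "P {4,5} = r # R3"
    "P {1,5} = p # R1" "P {2,5} = P2" "P {Suc 0,2} = [a, p]" "P {Suc 0,5} = p # R1"
    by (simp_all add: P_def doubleton_eq_iff)
  have Q[simp]: "Q {1,2} = [d1]" "Q {2,3} = [d2]" "Q {3,4} = [d3]" "Q {4,5} = Q3'"
    "Q {1,5} = Q1'" "Q {2,5} = Q2" "Q {Suc 0,2} = [d1]" "Q {Suc 0,5} = Q1'"
    by (simp_all add: Q_def doubleton_eq_iff)
  have E: "edges C5_plus = {{1,2},{2,3},{3,4},{4,5},{1,5},{2,5}}" "ends C5_plus = (\<lambda>e. e)"
    "verts C5_plus = {1,2,3,4,5}"
    by (auto simp: C5_plus_def)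
  have ne: "a \<noteq> p" "a \<noteq> q" "a \<noteq> r" "a \<noteq> b" "p \<noteq> b" "q \<noteq> r" "q \<noteq> b" "r \<noteq> b"
    using dist P1 P3 bR by auto
  have ni: "a \<notin> set R1" "p \<notin> set R1" "a \<notin> set R3" "q \<notin> set R3" "r \<notin> set R3"
    using dist P1 P3 by auto
  have ne2: "p \<noteq> q" "p \<noteq> r" "p \<notin> set R3" "q \<notin> set R1" "r \<notin> set R1"
    "p \<notin> set P2" "q \<notin> set P2" "r \<notin> set P2"
    using disj P1 P3 ne ni bR P2 by auto
  have int: "set R1 \<inter> set R3 \<subseteq> {b}" "set R1 \<inter> set P2 \<subseteq> {b}" "set R3 \<inter> set P2 \<subseteq> {b}"
    using disj ni unfolding P1(1) P3(1) list.set by blast+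
  have paths: "is_path G [a, p] [d1]" "is_path G (p # R1) Q1'" "is_path G [a, q] [d2]"
    "is_path G [q, r] [d3]" "is_path G (r # R3) Q3'"
    using path1 path3 unfolding P1 P3 Q1 Q3
    by (meson is_path_tl is_path_hd_edge)+
  have Qdisj: "d1 \<notin> set Q1'" "d2 \<noteq> d3" "d2 \<notin> set Q3'" "d3 \<notin> set Q3'" "d1 \<noteq> d2" "d1 \<noteq> d3"
    "d1 \<notin> set Q3'" "d2 \<notin> set Q1'" "d3 \<notin> set Q1'" "set Q1' \<inter> set Q3' = {}"
    "set Q1' \<inter> set Q2 = {}" "set Q3' \<inter> set Q2 = {}" "d1 \<notin> set Q2" "d2 \<notin> set Q2" "d3 \<notin> set Q2"
    using dist disjQ Q1 Q3 by auto
  have "subdivision_via C5_plus S f P Q"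
    unfolding subdivision_via_def
  proof (intro conjI)
    show "inj_on f (verts C5_plus)"
      using ne ne2 by (auto simp: E inj_on_def)
    have "is_path S (P e) (Q e)" if "e \<in> edges C5_plus" for e
      by (rule is_path_subgraph[of G])
        (use that paths path2 in \<open>auto simp: E P1 P3 Q1 Q3\<close>)
    moreover have "Q e \<noteq> []" if "e \<in> edges C5_plus" for e
      using that Q1 Q3 assms(12) by (auto simp: E)
    moreover have "{hd (P e), last (P e)} = f ` ends C5_plus e" if "e \<in> edges C5_plus" for e
      using that P1 P3 hd(2) last(2) by (auto simp: E)
    moreover have "set (P e) \<inter> f ` verts C5_plus = f ` ends C5_plus e" if "e \<in> edges C5_plus" for e
      using that unfolding E
      by (elim insertE emptyE; simp add: ne ne2 ni bR P2 ne[symmetric] ne2(1,2)[symmetric] insert_commute)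
    ultimately show "\<forall>e\<in>edges C5_plus. is_path S (P e) (Q e) \<and> Q e \<noteq> [] \<and>
       {hd (P e), last (P e)} = f ` ends C5_plus e \<and>
       set (P e) \<inter> f ` verts C5_plus = f ` ends C5_plus e" by blast
    define R where "R d e \<longleftrightarrow> set (P d) \<inter> set (P e) \<subseteq> f ` d \<inter> f ` e \<and> set (Q d) \<inter> set (Q e) = {}"
      for d e
    have R_sym: "R d e \<Longrightarrow> R e d" for d e by (auto simp: R_def)
    \<comment> \<open>As \<open>R\<close> is symmetric, only the fifteen unordered pairs of edges
      need checking.\<close>
    have "R {1, 2} {2, 3}" "R {1, 2} {3, 4}" "R {1, 2} {4, 5}" "R {1, 2} {1, 5}"
      "R {1, 2} {2, 5}" "R {2, 3} {3, 4}" "R {2, 3} {4, 5}" "R {2, 3} {1, 5}"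
      "R {2, 3} {2, 5}" "R {3, 4} {4, 5}" "R {3, 4} {1, 5}" "R {3, 4} {2, 5}"
      "R {4, 5} {1, 5}" "R {4, 5} {2, 5}" "R {1, 5} {2, 5}"
      using int Qdisj ne ni ne2 by (simp_all add: R_def) blast+
    from this this[THEN R_sym] have "\<forall>d\<in>edges C5_plus. \<forall>e\<in>edges C5_plus. d \<noteq> e \<longrightarrow> R d e"
      unfolding E by (simp only: ball_simps simp_thms)
    then show "\<forall>d\<in>edges C5_plus. \<forall>e\<in>edges C5_plus. d \<noteq> e \<longrightarrow>
       set (P d) \<inter> set (P e) \<subseteq> f ` ends C5_plus d \<inter> f ` ends C5_plus e \<and>
       set (Q d) \<inter> set (Q e) = {}" by (simp add: E R_def)
    show "verts S = f ` verts C5_plus \<union> (\<Union>e\<in>edges C5_plus. set (P e))"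
      using P1 P3 P2 bR by (auto simp: E)
    show "edges S = (\<Union>e\<in>edges C5_plus. set (Q e))"
      using Q1 Q3 by (auto simp: E)
  qed
  moreover have "\<forall>e\<in>edges C5_plus. odd (length (Q e))"
    using Q1 Q3 assms(12) by (auto simp: E)
  ultimately show ?thesis
    using sub unfolding odd_free_def totally_odd_subdivision_def by blast
qed

section \<open>Lower bounds on the fractional chromatic index\<close>

definition edges_within :: "('v, 'e) mgraph \<Rightarrow> 'v set \<Rightarrow> 'e set" where
  "edges_within G U = {d \<in> edges G. ends G d \<subseteq> U}"

lemma (in multigraph) finite_matchings: "finite (matchings G)"
  by (rule finite_subset[of _ "Pow (edges G)"]) (auto simp: matchings_def finite_edges)

lemma (in multigraph) finite_ends: "e \<in> edges G \<Longrightarrow> finite (ends G e)"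
  using card_ends card_eq_0_iff by fastforce

text \<open>The ends of the matching edges inside \<open>U\<close> are disjoint pairs of elements of
  \<open>U\<close>.\<close>

lemma (in multigraph) card_matching_within:
  assumes "M \<in> matchings G" "finite U"
  shows "2 * card (M \<inter> edges_within G U) \<le> card U"
proof -
  let ?N = "M \<inter> edges_within G U"
  have fin: "finite ?N"
    by (rule finite_subset[OF _ finite_edges]) (auto simp: edges_within_def)
  have "card (\<Union>d\<in>?N. ends G d) = (\<Sum>d\<in>?N. card (ends G d))"
  proof (rule card_UN_disjoint[OF fin])
    show "\<forall>i\<in>?N. finite (ends G i)" using finite_ends by (auto simp: edges_within_def)
    show "\<forall>i\<in>?N. \<forall>j\<in>?N. i \<noteq> j \<longrightarrow> ends G i \<inter> ends G j = {}"
      using assms(1) by (auto simp: matchings_def)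
  qed
  also have "\<dots> = (\<Sum>d\<in>?N. 2)"
    by (rule sum.cong) (auto simp: edges_within_def card_ends)
  finally have "card (\<Union>d\<in>?N. ends G d) = 2 * card ?N" by simp
  moreover have "(\<Union>d\<in>?N. ends G d) \<subseteq> U" by (auto simp: edges_within_def)
  ultimately show ?thesis using card_mono[OF assms(2)] by metis
qed

text \<open>Weak duality: the pairs of an edge \<open>e\<close> of \<open>A\<close> and a matching
  containing it, weighted by \<open>y\<close>, are summed in both orders.\<close>

lemma (in multigraph) card_le_fractional_edge_cover:
  assumes y: "fractional_edge_cover G y" and A: "A \<subseteq> edges G"
    and r: "\<And>M. M \<in> matchings G \<Longrightarrow> card (M \<inter> A) \<le> r"
  shows "of_nat (card A) \<le> of_nat r * (\<Sum>M\<in>matchings G. y M)"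
proof -
  note fin = finite_matchings
  have finA: "finite A" using A finite_edges finite_subset by blast
  have "of_nat (card A) = (\<Sum>e\<in>A. 1 :: rat)" by simp
  also have "\<dots> \<le> (\<Sum>e\<in>A. \<Sum>M | M \<in> matchings G \<and> e \<in> M. y M)"
    using y A by (intro sum_mono) (auto simp: fractional_edge_cover_def)
  also have "\<dots> = (\<Sum>e\<in>A. \<Sum>M\<in>matchings G. if e \<in> M then y M else 0)"
    by (intro sum.cong refl sum.mono_neutral_cong_left fin) auto
  also have "\<dots> = (\<Sum>M\<in>matchings G. \<Sum>e\<in>A. if e \<in> M then y M else 0)"
    by (rule sum.swap)
  also have "\<dots> = (\<Sum>M\<in>matchings G. of_nat (card (M \<inter> A)) * y M)"
    by (intro sum.cong refl) (simp add: sum.If_cases[OF finA] Int_commute Collect_mem_eq)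
  also have "\<dots> \<le> (\<Sum>M\<in>matchings G. of_nat r * y M)"
    using y r by (intro sum_mono mult_right_mono) (auto simp: fractional_edge_cover_def)
  finally show ?thesis by (simp add: sum_distrib_left)
qed

text \<open>Weighting a matching by the number of its indices counts repetitions among the
  \<open>M i\<close>, so that the total is exactly \<open>k\<close>.\<close>

lemma (in multigraph) fractional_edge_cover_of_matchings:
  assumes M: "\<And>i. i < k \<Longrightarrow> M i \<in> matchings G" and cov: "edges G \<subseteq> (\<Union>i<k. M i)"
  defines "y \<equiv> \<lambda>N. of_nat (card {i. i < k \<and> M i = N}) :: rat"
  shows "fractional_edge_cover G y" "(\<Sum>N\<in>matchings G. y N) = of_nat k"
proof -
  note fin = finite_matchings
  have sum_y: "(\<Sum>N\<in>\<N>. y N) = of_nat (card {i. i < k \<and> M i \<in> \<N>})" if "\<N> \<subseteq> matchings G" for \<N>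
  proof -
    have finN: "finite \<N>" using that fin finite_subset by blast
    have "(\<Sum>N\<in>\<N>. y N) = of_nat (\<Sum>N\<in>\<N>. card {i. i < k \<and> M i = N})"
      by (simp add: y_def)
    also have "(\<Sum>N\<in>\<N>. card {i. i < k \<and> M i = N}) = card (\<Union>N\<in>\<N>. {i. i < k \<and> M i = N})"
      by (rule card_UN_disjoint[symmetric]) (use finN in auto)
    also have "(\<Union>N\<in>\<N>. {i. i < k \<and> M i = N}) = {i. i < k \<and> M i \<in> \<N>}" by auto
    finally show ?thesis .
  qed
  have "{i. i < k \<and> M i \<in> matchings G} = {..<k}" using M by auto
  then show "(\<Sum>N\<in>matchings G. y N) = of_nat k" using sum_y[of "matchings G"] by simp
  show "fractional_edge_cover G y"
    unfolding fractional_edge_cover_def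
  proof (intro conjI ballI)
    fix e assume "e \<in> edges G"
    then obtain i where "i < k" "e \<in> M i" using cov by auto
    then have "{i. i < k \<and> M i \<in> {N. N \<in> matchings G \<and> e \<in> N}} \<noteq> {}" using M by auto
    then have "card {i. i < k \<and> M i \<in> {N. N \<in> matchings G \<and> e \<in> N}} \<ge> 1"
      by (simp add: Suc_le_eq card_gt_0_iff)
    then show "1 \<le> (\<Sum>N | N \<in> matchings G \<and> e \<in> N. y N)"
      by (subst sum_y) auto
  qed (simp add: y_def)
qed

text \<open>Single edges are matchings. This makes the set under the infimum nonempty.\<close>

lemma (in multigraph) fractional_edge_cover_exists: "\<exists>y. fractional_edge_cover G y"
proof -
  obtain h where h: "bij_betw h {..<card (edges G)} (edges G)"
    using ex_bij_betw_nat_finite[OF finite_edges] by (auto simp: atLeast0LessThan)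
  have "{h i} \<in> matchings G" if "i < card (edges G)" for i
    using h that by (auto simp: matchings_def bij_betw_def)
  moreover have "edges G \<subseteq> (\<Union>i<card (edges G). {h i})" using h by (auto simp: bij_betw_def)
  ultimately show ?thesis
    using fractional_edge_cover_of_matchings(1)[of "card (edges G)" "\<lambda>i. {h i}"] by blast
qed

lemma (in multigraph) card_le_fractional_chromatic_index:
  assumes A: "A \<subseteq> edges G" and r: "\<And>M. M \<in> matchings G \<Longrightarrow> card (M \<inter> A) \<le> r"
  shows "real (card A) \<le> real r * fractional_chromatic_index G"
\<comment> \<open>For \<open>r = 0\<close> the existence of some cover forces \<open>A\<close> to be
  empty. Otherwise dividing by \<open>r\<close> gives a lower bound for the total weight of every
  cover, hence for the infimum.\<close>
proof (cases "r = 0")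
  case True
  then show ?thesis
    using card_le_fractional_edge_cover[OF _ A r] fractional_edge_cover_exists by fastforce
next
  case False
  have "real (card A) / real r \<le> fractional_chromatic_index G"
    unfolding fractional_chromatic_index_def
  proof (rule cInf_greatest)
    fix x assume "x \<in> {real_of_rat (\<Sum>M\<in>matchings G. y M) |y. fractional_edge_cover G y}"
    then obtain y where y: "fractional_edge_cover G y" "x = real_of_rat (\<Sum>M\<in>matchings G. y M)"
      by auto
    have "real_of_rat (of_nat (card A)) \<le> real_of_rat (of_nat r * (\<Sum>M\<in>matchings G. y M))"
      using card_le_fractional_edge_cover[OF y(1) A r] by (simp only: of_rat_less_eq)
    then have "real (card A) \<le> real r * x" by (simp add: y(2) of_rat_mult)
    then show "real (card A) / real r \<le> x" using False by (simp add: field_simps)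
  qed (use fractional_edge_cover_exists in auto)
  then show ?thesis using False by (simp add: field_simps)
qed

lemma (in multigraph) fractional_chromatic_index_le:
  assumes "\<And>i. i < k \<Longrightarrow> M i \<in> matchings G" "edges G \<subseteq> (\<Union>i<k. M i)"
  shows "fractional_chromatic_index G \<le> real k"
  unfolding fractional_chromatic_index_def
proof (rule cInf_lower)
  show "real k \<in> {real_of_rat (\<Sum>M\<in>matchings G. y M) |y. fractional_edge_cover G y}"
    using fractional_edge_cover_of_matchings[OF assms] by force
  have "0 \<le> (\<Sum>M\<in>matchings G. y M)" if "fractional_edge_cover G y" for y
    using that by (intro sum_nonneg) (auto simp: fractional_edge_cover_def)
  then show "bdd_below {real_of_rat (\<Sum>M\<in>matchings G. y M) |y. fractional_edge_cover G y}"
    by (intro bdd_belowI[of _ 0]) auto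
qed

lemma (in multigraph) fractional_chromatic_index_nonneg: "0 \<le> fractional_chromatic_index G"
  using card_le_fractional_chromatic_index[of "{}" 1] by simp

text \<open>Edges at a common vertex meet, so a matching contains at most one of them.\<close>

lemma (in multigraph) degree_le_ceiling_fractional_chromatic_index:
  "int (card {e \<in> edges G. v \<in> ends G e}) \<le> \<lceil>fractional_chromatic_index G\<rceil>"
proof -
  have "card (M \<inter> {e \<in> edges G. v \<in> ends G e}) \<le> 1" if "M \<in> matchings G" for M
    using that by (intro card_le_Suc0_iff_eq[THEN iffD2, simplified One_nat_def[symmetric]])
      (auto simp: matchings_def finite_edges)
  from card_le_fractional_chromatic_index[OF _ this]
  show ?thesis by simp linarith
qed

text \<open>By parity a matching has at most \<open>(card U - 1) / 2\<close> edges inside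
  \<open>U\<close>.\<close>

lemma (in multigraph) card_edges_within_le_ceiling_fractional_chromatic_index:
  assumes "odd (card U)"
  shows "2 * int (card (edges_within G U)) \<le> \<lceil>fractional_chromatic_index G\<rceil> * (int (card U) - 1)"
proof -
  obtain m where m: "card U = 2 * m + 1" using assms by (rule oddE)
  \<comment> \<open>Infinite sets have cardinality 0, which is even.\<close>
  then have "finite U" by (metis add_is_0 card.infinite one_neq_zero)
  have "card (M \<inter> edges_within G U) \<le> m" if "M \<in> matchings G" for M
    using card_matching_within[OF that \<open>finite U\<close>] m by linarith
  from card_le_fractional_chromatic_index[OF _ this]
  have "real (card (edges_within G U)) \<le> real m * fractional_chromatic_index G"
    by (auto simp: edges_within_def)
  also have "\<dots> \<le> real m * real_of_int \<lceil>fractional_chromatic_index G\<rceil>"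
    by (intro mult_left_mono) auto
  finally have "real_of_int (int (card (edges_within G U))) \<le>
      real_of_int (int m * \<lceil>fractional_chromatic_index G\<rceil>)" by simp
  then have "int (card (edges_within G U)) \<le> int m * \<lceil>fractional_chromatic_index G\<rceil>"
    by (simp only: of_int_le_iff)
  then show ?thesis by (simp add: m algebra_simps)
qed

section \<open>Kempe chains\<close>

text \<open>Proper edge colouring of the part \<open>D\<close> only, so that partial colourings live
  on the same graph.\<close>

definition colouring :: "('v, 'e) mgraph \<Rightarrow> nat \<Rightarrow> 'e set \<Rightarrow> ('e \<Rightarrow> nat) \<Rightarrow> bool" where
  "colouring G k D \<phi> \<longleftrightarrow> (\<forall>d\<in>D. \<phi> d < k) \<and>
    (\<forall>d\<in>D. \<forall>e\<in>D. \<phi> d = \<phi> e \<longrightarrow> ends G d \<inter> ends G e \<noteq> {} \<longrightarrow> d = e)"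

definition missing :: "('v, 'e) mgraph \<Rightarrow> 'e set \<Rightarrow> ('e \<Rightarrow> nat) \<Rightarrow> 'v \<Rightarrow> nat \<Rightarrow> bool" where
  "missing G D \<phi> v a \<longleftrightarrow> (\<forall>d\<in>D. v \<in> ends G d \<longrightarrow> \<phi> d \<noteq> a)"

definition alternating ::
  "('v, 'e) mgraph \<Rightarrow> 'e set \<Rightarrow> ('e \<Rightarrow> nat) \<Rightarrow> nat \<Rightarrow> nat \<Rightarrow> 'v list \<Rightarrow> 'e list \<Rightarrow> bool"
where
  "alternating G D \<phi> a b vs es \<longleftrightarrow> is_path G vs es \<and> set es \<subseteq> D \<and>
    (\<forall>i<length es. \<phi> (es ! i) = (if even i then a else b))"

text \<open>The last condition makes the path a whole component of the subgraph formed by the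
  colours \<open>a\<close> and \<open>b\<close>. As \<open>b\<close> is missing at the first vertex,
  this component can only start with an edge of colour \<open>a\<close>.\<close>

definition kempe_chain ::
  "('v, 'e) mgraph \<Rightarrow> 'e set \<Rightarrow> ('e \<Rightarrow> nat) \<Rightarrow> nat \<Rightarrow> nat \<Rightarrow> 'v list \<Rightarrow> 'e list \<Rightarrow> bool"
where
  "kempe_chain G D \<phi> a b vs es \<longleftrightarrow> alternating G D \<phi> a b vs es \<and> missing G D \<phi> (vs ! 0) b \<and>
    (\<forall>d\<in>D. \<phi> d \<in> {a, b} \<longrightarrow> ends G d \<inter> set vs \<noteq> {} \<longrightarrow> d \<in> set es)"

text \<open>Every colour on \<open>X\<close> other than \<open>a\<close> becomes \<open>a\<close>,
  so this is an exchange when \<open>X\<close> carries only \<open>a\<close> and \<open>b\<close>,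
  as the edges of a chain do.\<close>

definition swap_colours :: "nat \<Rightarrow> nat \<Rightarrow> 'e set \<Rightarrow> ('e \<Rightarrow> nat) \<Rightarrow> 'e \<Rightarrow> nat" where
  "swap_colours a b X \<phi> d = (if d \<in> X then if \<phi> d = a then b else a else \<phi> d)"

lemma colouring_unique:
  assumes "colouring G k D \<phi>" "d \<in> D" "e \<in> D" "\<phi> d = \<phi> e" "v \<in> ends G d" "v \<in> ends G e"
  shows "d = e"
  using assms unfolding colouring_def by blast

lemma colouring_insert:
  assumes "colouring G k D \<phi>" "a < k" "\<And>v. v \<in> ends G e \<Longrightarrow> missing G D \<phi> v a"
  shows "colouring G k (insert e D) (\<phi>(e := a))"
proof -
  have "\<phi> d \<noteq> a" if "d \<in> D" "ends G d \<inter> ends G e \<noteq> {}" for d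
    using assms(3) that unfolding missing_def by blast
  moreover have "ends G d \<inter> ends G e \<noteq> {}" if "ends G e \<inter> ends G d \<noteq> {}" for d
    using that by blast
  ultimately show ?thesis
    using assms(1,2) unfolding colouring_def
    by (intro conjI ballI impI) (simp_all split: if_splits, blast+)
qed

text \<open>A longest alternating path from \<open>v\<close> is closed: a further edge of colour
  \<open>a\<close> or \<open>b\<close> touching it would prolong it.\<close>

lemma (in multigraph) kempe_chain_exists:
  assumes D: "D \<subseteq> edges G" and col: "colouring G k D \<phi>" and v: "v \<in> verts G"
    and miss: "missing G D \<phi> v b"
  obtains vs es where "kempe_chain G D \<phi> a b vs es" "vs ! 0 = v"
proof -
  define P where
    "P m \<longleftrightarrow> (\<exists>vs es. alternating G D \<phi> a b vs es \<and> vs ! 0 = v \<and> length es = m)" for m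
  have "P 0"
    unfolding P_def using v
    by (intro exI[of _ "[v]"] exI[of _ "[]"]) (auto simp: alternating_def is_path_def)
  moreover have "m \<le> card (verts G)" if Pm: "P m" for m
  proof -
    obtain vs es where *: "is_path G vs es" "length es = m"
      using Pm unfolding P_def alternating_def by blast
    then have "Suc m = card (set vs)" by (simp add: is_path_def distinct_card)
    also have "\<dots> \<le> card (verts G)"
      using * finite_verts by (intro card_mono) (auto simp: is_path_def)
    finally show ?thesis by simp
  qed
  ultimately obtain m where m: "P m" "\<And>m'. P m' \<Longrightarrow> m' \<le> m"
    using Nat.ex_has_greatest_nat[of P 0] by blast
  then obtain vs es where
    alt: "alternating G D \<phi> a b vs es" and hd: "vs ! 0 = v" and len: "length es = m"
    by (auto simp: P_def)
  have path: "length vs = Suc m" "distinct vs" "set vs \<subseteq> verts G" "set es \<subseteq> D"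
    "\<And>i. i < m \<Longrightarrow> ends G (es ! i) = {vs ! i, vs ! Suc i}"
    "\<And>i. i < m \<Longrightarrow> \<phi> (es ! i) = (if even i then a else b)"
    using alt len by (auto simp: alternating_def is_path_def)
  \<comment> \<open>Vertices of the path before the last already have their edges of both colours on
    the path, or miss \<open>b\<close> in the case of the first one. So a further edge can only meet
    the last vertex, with the colour that is next in turn.\<close>
  have last_only: "i = m \<and> \<phi> d = (if even m then a else b)"
    if d: "d \<in> D" "\<phi> d \<in> {a, b}" "d \<notin> set es" and i: "i \<le> m" "vs ! i \<in> ends G d" for d i
  proof -
    have out: "\<phi> d \<noteq> (if even i then a else b)" if "i < m"
    proof
      assume "\<phi> d = (if even i then a else b)"
      then have "d = es ! i"
        using that path d i len by (intro colouring_unique[OF col, of _ _ "vs ! i"]) auto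
      then show False using that d len by auto
    qed
    have into: "\<phi> d \<noteq> (if even i then b else a)"
    proof (cases i)
      case 0
      then show ?thesis using miss hd i d by (auto simp: missing_def)
    next
      case (Suc i')
      show ?thesis
      proof
        assume "\<phi> d = (if even i then b else a)"
        then have "d = es ! i'"
          using Suc path d i len by (intro colouring_unique[OF col, of _ _ "vs ! i"]) auto
        then show False using Suc i d len by auto
      qed
    qed
    have "i = m" using out into d(2) i(1) by (cases "i < m") (auto split: if_splits)
    then show ?thesis using into d(2) by (auto split: if_splits)
  qed
  have "d \<in> set es" if d: "d \<in> D" "\<phi> d \<in> {a, b}" "ends G d \<inter> set vs \<noteq> {}" for d
  proof (rule ccontr)
    assume nd: "d \<notin> set es"
    obtain i where i: "i \<le> m" "vs ! i \<in> ends G d"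
      using d(3) path(1) by (metis IntE all_not_in_conv in_set_conv_nth less_Suc_eq_le)
    have im: "i = m" "\<phi> d = (if even m then a else b)" using last_only[OF d(1,2) nd i] by auto
    obtain w where w: "ends G d = {vs ! m, w}" "w \<noteq> vs ! m"
    proof -
      have "card (ends G d) = 2" using d(1) D card_ends by auto
      then obtain x z where "ends G d = {x, z}" "x \<noteq> z" by (auto simp: card_2_iff)
      then show ?thesis using that[of x] that[of z] i im by (auto simp: insert_commute)
    qed
    have "w \<notin> set vs"
    proof
      assume "w \<in> set vs"
      then obtain j where "j \<le> m" "vs ! j = w"
        using path(1) by (metis in_set_conv_nth less_Suc_eq_le)
      then show False using last_only[OF d(1,2) nd, of j] w by auto
    qed
    moreover have "w \<in> verts G" using ends_subset[of d] D d(1) w(1) by auto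
    ultimately have "alternating G D \<phi> a b (vs @ [w]) (es @ [d])"
      using alt D d(1) w(1) im len path(1)
      by (auto simp: alternating_def is_path_def nth_append less_Suc_eq)
    moreover have "(vs @ [w]) ! 0 = v" using hd path(1) by (simp add: nth_append)
    ultimately have "P (Suc m)" unfolding P_def using len by fastforce
    then show False using m(2) by fastforce
  qed
  then have "kempe_chain G D \<phi> a b vs es"
    using alt hd miss by (simp add: kempe_chain_def)
  then show ?thesis using that hd by blast
qed

lemma kempe_chain_edges:
  assumes "kempe_chain G D \<phi> a b vs es" "d \<in> set es"
  shows "d \<in> D" "\<phi> d \<in> {a, b}" "ends G d \<subseteq> set vs"
proof -
  obtain i where "i < length es" "es ! i = d"
    using assms(2) by (auto simp: in_set_conv_nth)
  then show "d \<in> D" "\<phi> d \<in> {a, b}" "ends G d \<subseteq> set vs"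
    using assms by (auto simp: kempe_chain_def alternating_def is_path_def)
qed

text \<open>No edge outside the chain that meets it has colour \<open>a\<close> or \<open>b\<close>,
  so the exchange creates no conflict.\<close>

lemma kempe_chain_swap:
  assumes chain: "kempe_chain G D \<phi> a b vs es"
    and col: "colouring G k D \<phi>" and "a \<noteq> b" "a < k" "b < k"
  defines "\<phi>' \<equiv> swap_colours a b (set es) \<phi>"
  shows "colouring G k D \<phi>'"
    and "missing G D \<phi>' (vs ! 0) a"
    and "\<And>w c. w \<notin> set vs \<Longrightarrow> missing G D \<phi> w c \<Longrightarrow> missing G D \<phi>' w c"
    and "\<And>w c. c \<notin> {a, b} \<Longrightarrow> missing G D \<phi> w c \<Longrightarrow> missing G D \<phi>' w c"
proof -
  note in_chain = kempe_chain_edges[OF chain]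
  have closed: "d \<in> set es" if "d \<in> D" "\<phi> d \<in> {a, b}" "ends G d \<inter> set vs \<noteq> {}" for d
    using chain that by (auto simp: kempe_chain_def)
  have cross: "False" if "d \<in> set es" "e \<in> D" "e \<notin> set es" "\<phi>' d = \<phi>' e"
    "ends G d \<inter> ends G e \<noteq> {}" for d e
    using closed[of e] in_chain[OF that(1)] that by (auto simp: \<phi>'_def swap_colours_def split: if_splits)
  show "colouring G k D \<phi>'"
    unfolding colouring_def
  proof (intro conjI ballI impI)
    fix d assume "d \<in> D"
    then show "\<phi>' d < k" using col assms(4,5) by (auto simp: \<phi>'_def swap_colours_def colouring_def)
  next
    fix d e assume *: "d \<in> D" "e \<in> D" "\<phi>' d = \<phi>' e" "ends G d \<inter> ends G e \<noteq> {}"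
    have "d \<in> set es \<longleftrightarrow> e \<in> set es"
      using cross[of d e] cross[of e d] * by (metis Int_commute)
    then have "\<phi> d = \<phi> e"
      using * in_chain(2)[of d] in_chain(2)[of e] \<open>a \<noteq> b\<close>
      by (auto simp: \<phi>'_def swap_colours_def split: if_splits)
    then show "d = e" using col * by (auto simp: colouring_def)
  qed
  have start: "vs ! 0 \<in> set vs" "missing G D \<phi> (vs ! 0) b"
    using chain by (auto simp: kempe_chain_def alternating_def is_path_def)
  show "missing G D \<phi>' (vs ! 0) a"
    unfolding missing_def
  proof (intro ballI impI)
    fix d assume d: "d \<in> D" "vs ! 0 \<in> ends G d"
    then have "\<phi> d \<noteq> b" using start(2) by (auto simp: missing_def)
    moreover have "d \<in> set es" if "\<phi> d = a" using closed[of d] that d start(1) by auto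
    ultimately show "\<phi>' d \<noteq> a"
      using in_chain(2)[of d] \<open>a \<noteq> b\<close> by (auto simp: \<phi>'_def swap_colours_def)
  qed
  show "missing G D \<phi>' w c" if "w \<notin> set vs" "missing G D \<phi> w c" for w c
    using that in_chain(3) by (auto simp: missing_def \<phi>'_def swap_colours_def)
  show "missing G D \<phi>' w c" if "c \<notin> {a, b}" "missing G D \<phi> w c" for w c
    using that by (auto simp: missing_def \<phi>'_def swap_colours_def)
qed

section \<open>Odd cycles and their odd ears\<close>

text \<open>An odd cycle is given by periodic sequences of vertices and edges, so that rotating it is
  shifting the index.\<close>

definition odd_cycle :: "('v, 'e) mgraph \<Rightarrow> nat \<Rightarrow> (nat \<Rightarrow> 'v) \<Rightarrow> (nat \<Rightarrow> 'e) \<Rightarrow> bool" where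
  "odd_cycle G n u c \<longleftrightarrow> odd n \<and> 3 \<le> n \<and> inj_on u {..<n} \<and>
    (\<forall>i. u (i + n) = u i \<and> c (i + n) = c i \<and> c i \<in> edges G \<and> ends G (c i) = {u i, u (Suc i)})"

lemma periodic_mod:
  fixes f :: "nat \<Rightarrow> 'a"
  assumes "\<And>i. f (i + n) = f i"
  shows "f (i mod n) = f i"
proof -
  have "f (j + k * n) = f j" for j k
  proof (induction k)
    case (Suc k)
    then show ?case using assms[of "j + k * n"] by (simp add: ac_simps)
  qed simp
  from this[of "i mod n" "i div n"] show ?thesis by simp
qed

lemma Suc_mod_eq_iff:
  fixes n :: nat
  shows "Suc i mod n = Suc j mod n \<longleftrightarrow> i mod n = j mod n"
proof
  assume "Suc i mod n = Suc j mod n"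
  then show "i mod n = j mod n"
  proof (cases "n = 0")
    case False
    have "(i + n) mod n = (Suc i + (n - 1)) mod n" using False by simp
    also have "\<dots> = (Suc j + (n - 1)) mod n"
      using \<open>Suc i mod n = Suc j mod n\<close> by (rule mod_add_cong) simp
    also have "\<dots> = (j + n) mod n" using False by simp
    finally show ?thesis by simp
  qed simp
next
  assume "i mod n = j mod n"
  then show "Suc i mod n = Suc j mod n" by (metis mod_Suc_eq)
qed

lemma odd_cycle_vertex_eq_iff:
  assumes "odd_cycle G n u c"
  shows "u i = u j \<longleftrightarrow> i mod n = j mod n"
proof -
  have "u (i mod n) = u i" "u (j mod n) = u j"
    using assms by (intro periodic_mod; simp add: odd_cycle_def)+
  moreover have "u (i mod n) = u (j mod n) \<longleftrightarrow> i mod n = j mod n"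
    using assms by (intro inj_on_eq_iff[of u "{..<n}"]) (auto simp: odd_cycle_def)
  ultimately show ?thesis by simp
qed

lemma odd_cycle_edge_mod:
  assumes "odd_cycle G n u c"
  shows "c (i mod n) = c i"
  using assms by (intro periodic_mod; simp add: odd_cycle_def)

lemma odd_cycle_edge_eq_iff:
  assumes "odd_cycle G n u c"
  shows "c i = c j \<longleftrightarrow> i mod n = j mod n"
proof
  assume "c i = c j"
  then have "{u i, u (Suc i)} = {u j, u (Suc j)}"
    using assms by (metis odd_cycle_def)
  then have "i mod n = j mod n \<or> i mod n = Suc j mod n \<and> Suc i mod n = j mod n"
    by (auto simp: doubleton_eq_iff odd_cycle_vertex_eq_iff[OF assms])
  \<comment> \<open>Crossed ends would give \<open>j + 2\<close> congruent to \<open>j\<close>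
    modulo \<open>n\<close>, impossible for \<open>n\<close> at least 3.\<close>
  moreover have False if "i mod n = Suc j mod n" "Suc i mod n = j mod n"
  proof -
    have "Suc (Suc j) mod n = Suc i mod n" using that(1) Suc_mod_eq_iff by metis
    then have "(j + 2) mod n = j mod n" using that(2) by simp
    then have "n dvd j + 2 - j" by (subst mod_eq_dvd_iff_nat[symmetric]) auto
    then have "n dvd 2" by simp
    then show False using assms by (auto simp: odd_cycle_def dest!: dvd_imp_le)
  qed
  ultimately show "i mod n = j mod n" by blast
next
  assume "i mod n = j mod n"
  then show "c i = c j" using odd_cycle_edge_mod[OF assms] by metis
qed

lemma odd_cycle_shift:
  assumes "odd_cycle G n u c"
  shows "odd_cycle G n (\<lambda>i. u (i + k)) (\<lambda>i. c (i + k))"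
proof -
  have "inj_on (\<lambda>i. u (i + k)) {..<n}"
  proof (rule inj_onI)
    fix i j assume *: "i \<in> {..<n}" "j \<in> {..<n}" "u (i + k) = u (j + k)"
    then have "(i + k) mod n = (j + k) mod n"
      using odd_cycle_vertex_eq_iff[OF assms] by simp
    then have "i mod n = j mod n" by (induction k) (simp_all add: Suc_mod_eq_iff)
    then show "i = j" using * by simp
  qed
  moreover have "u (i + n + k) = u (i + k)" "c (i + n + k) = c (i + k)" for i
    using assms by (metis odd_cycle_def add.commute add.left_commute)+
  ultimately show ?thesis using assms by (simp add: odd_cycle_def)
qed

lemma range_shift_periodic:
  fixes f :: "nat \<Rightarrow> 'a"
  assumes "\<And>i. f (i + n) = f i" "0 < n"
  shows "range (\<lambda>i. f (i + k)) = range f"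
proof -
  have "f i \<in> range (\<lambda>i. f (i + k))" for i
  proof -
    have "f i = f ((i + k * n) mod n)" using periodic_mod[of f, OF assms(1)] by simp
    also have "\<dots> = f (i + k * n)" by (rule periodic_mod[of f, OF assms(1)])
    also have "i + k * n = (i + k * (n - 1)) + k" using assms(2) by (cases n) auto
    finally show ?thesis by (metis rangeI)
  qed
  then show ?thesis by auto
qed

lemma odd_cycle_range_shift:
  assumes "odd_cycle G n u c"
  shows "range (\<lambda>i. u (i + k)) = range u" "range (\<lambda>i. c (i + k)) = range c"
  using assms by (intro range_shift_periodic[of _ n]; simp add: odd_cycle_def)+

lemma odd_cycle_range_eq:
  assumes "odd_cycle G n u c"
  shows "range u = u ` {..<n}" "range c = c ` {..<n}"
proof -
  have "u i \<in> u ` {..<n}" "c i \<in> c ` {..<n}" for i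
    using assms odd_cycle_vertex_eq_iff[OF assms, of i "i mod n"]
      odd_cycle_edge_mod[OF assms, of i]
    by (auto simp: odd_cycle_def intro!: image_eqI[of _ _ "i mod n"])
  then show "range u = u ` {..<n}" "range c = c ` {..<n}" by auto
qed

text \<open>The two directions out of \<open>u 0\<close>. The backward path starts at
  \<open>u n\<close>, which equals \<open>u 0\<close>, and takes \<open>j\<close> steps; the
  complementary arc to \<open>u j\<close> arises from it with \<open>n - j\<close> for
  \<open>j\<close>.\<close>

lemma (in multigraph) odd_cycle_path:
  assumes cyc: "odd_cycle G n u c" and j: "0 < j" "j < n"
  shows "is_path G (map u [0..<Suc j]) (map c [0..<j])"
    and "is_path G (map (\<lambda>t. u (n - t)) [0..<Suc j]) (map (\<lambda>t. c (n - Suc t)) [0..<j])"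
proof -
  have uv: "u i \<in> verts G" for i
    using cyc ends_subset[of "c i"] by (auto simp: odd_cycle_def)
  have inj: "s = t" if "u s = u t" "s < n" "t < n" for s t
    using that odd_cycle_vertex_eq_iff[OF cyc, of s t] by simp
  have inj': "s = t" if "u (n - s) = u (n - t)" "s < n" "t < n" for s t
  proof -
    have "(n - s) mod n = (n - t) mod n"
      using that odd_cycle_vertex_eq_iff[OF cyc] by simp
    then show ?thesis using that by (cases "s = 0"; cases "t = 0") auto
  qed
  have nth: "map f [0..<Suc j] ! t = f t" if "t \<le> j" for f :: "nat \<Rightarrow> 'v" and t
    using that by (simp add: nth_map del: upt_Suc)
  show "is_path G (map u [0..<Suc j]) (map c [0..<j])"
    using cyc j uv inj unfolding is_path_def odd_cycle_def
    by (auto simp: distinct_map inj_on_def nth simp del: upt_Suc)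
  have "ends G (c (n - Suc t)) = {u (n - t), u (n - Suc t)}" if "t < j" for t
  proof -
    have "Suc (n - Suc t) = n - t" using that j by simp
    then show ?thesis using cyc unfolding odd_cycle_def by (metis insert_commute)
  qed
  then show "is_path G (map (\<lambda>t. u (n - t)) [0..<Suc j]) (map (\<lambda>t. c (n - Suc t)) [0..<j])"
    using cyc j uv inj' unfolding is_path_def odd_cycle_def
    by (auto simp: distinct_map inj_on_def nth simp del: upt_Suc)
qed

text \<open>The ends of the ear split the odd cycle into an even and an odd arc. Together with the
  ear these form a theta graph with one even and two odd paths, so both odd paths have length 1, and
  the ear is parallel to the cycle edge that forms the odd arc.\<close>

lemma (in multigraph) odd_ear_of_odd_cycle:
  assumes free: "odd_free C5_plus G" and cyc: "odd_cycle G n u c"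
    and path: "is_path G vs es" "odd (length es)"
    and ends_on: "vs ! 0 \<in> range u" "vs ! length es \<in> range u"
    and off: "\<And>t. 0 < t \<Longrightarrow> t < length es \<Longrightarrow> vs ! t \<notin> range u"
    and edges_off: "set es \<inter> range c = {}"
  shows "length es = 1 \<and> (\<exists>i. ends G (es ! 0) = {u i, u (Suc i)})"
proof -
  obtain k where k: "vs ! 0 = u k" using ends_on by auto
  \<comment> \<open>The cycle is rotated so that the ear starts at \<open>v 0\<close>; its other end
    is \<open>v j\<close>.\<close>
  define v where "v = (\<lambda>i. u (i + k))"
  define d where "d = (\<lambda>i. c (i + k))"
  have cyc': "odd_cycle G n v d" unfolding v_def d_def by (rule odd_cycle_shift[OF cyc])
  have ran: "range v = range u" "range d = range c"
    unfolding v_def d_def by (rule odd_cycle_range_shift[OF cyc])+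
  have n: "odd n" "3 \<le> n" using cyc by (auto simp: odd_cycle_def)
  have vn: "v (i + n) = v i" for i using cyc' by (auto simp: odd_cycle_def)
  have v_eq: "v i = v j \<longleftrightarrow> i mod n = j mod n" for i j by (rule odd_cycle_vertex_eq_iff[OF cyc'])
  have d_eq: "d i = d j \<longleftrightarrow> i mod n = j mod n" for i j by (rule odd_cycle_edge_eq_iff[OF cyc'])
  have vs0: "vs ! 0 = v 0" by (simp add: v_def k)
  obtain j where j: "j < n" "vs ! length es = v j"
    using ends_on(2) odd_cycle_range_eq(1)[OF cyc'] ran(1) by auto
  have lenvs: "length vs = Suc (length es)" and dist: "distinct vs"
    using path(1) by (auto simp: is_path_def)
  have hd_vs: "hd vs = v 0" and last_vs: "last vs = v j"
    using vs0 j(2) lenvs by (simp_all add: hd_conv_nth last_conv_nth flip: length_greater_0_conv)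
  have "length es > 0" using path(2) by (auto simp: odd_pos)
  have "vs ! 0 \<noteq> vs ! length es"
    using lenvs dist \<open>length es > 0\<close> by (subst nth_eq_iff_index_eq) auto
  then have "j \<noteq> 0" using vs0 j(2) by (intro notI) simp
  then have j0: "0 < j" by simp
  define A where "A = map v [0..<Suc j]"
  define B where "B = map (\<lambda>t. v (n - t)) [0..<Suc (n - j)]"
  define A' where "A' = map d [0..<j]"
  define B' where "B' = map (\<lambda>t. d (n - Suc t)) [0..<n - j]"
  have pA: "is_path G A A'" unfolding A_def A'_def by (rule odd_cycle_path[OF cyc' j0 j(1)])
  have pB: "is_path G B B'" unfolding B_def B'_def
    by (rule odd_cycle_path[OF cyc']) (use j0 j in auto)
  have v_n: "v n = v 0" using vn[of 0] by simp
  have hdAB: "hd A = v 0" "hd B = v 0"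
    using v_n by (simp_all add: A_def B_def hd_map upt_conv_Cons del: upt_Suc)
  have lastAB: "last A = v j" "last B = v j" using j(1) by (simp_all add: A_def B_def)
  have vs_off: "x \<in> {v 0, v j}" if x: "x \<in> set vs" "x \<in> range v" for x
  proof -
    obtain t where t: "t \<le> length es" "vs ! t = x"
      using x(1) lenvs by (auto simp: in_set_conv_nth less_Suc_eq_le)
    then show ?thesis using off[of t] x(2) vs0 j(2) ran by (cases "t = 0"; cases "t = length es") auto
  qed
  have setA: "set A = v ` {0..j}" "set A' = d ` {0..<j}"
    by (auto simp: A_def A'_def atLeastLessThanSuc_atLeastAtMost simp del: upt_Suc)
  have setB: "set B = v ` {j..n}"
  proof -
    have "x \<in> (\<lambda>t. n - t) ` {0..n - j}" if "x \<in> {j..n}" for x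
      using that by (intro image_eqI[of _ _ "n - x"]) auto
    then have "(\<lambda>t. n - t) ` {0..n - j} = {j..n}" using j(1) by auto
    then have "v ` {j..n} = (\<lambda>t. v (n - t)) ` {0..n - j}" by (metis image_image)
    then show ?thesis
      by (simp add: B_def atLeastLessThanSuc_atLeastAtMost del: upt_Suc)
  qed
  have setB': "set B' \<subseteq> d ` {j..<n}" using j by (auto simp: B'_def)
  have dA: "set A \<inter> set B \<subseteq> {v 0, v j}"
  proof
    fix x assume "x \<in> set A \<inter> set B"
    then obtain s t where st: "s \<le> j" "j \<le> t" "t \<le> n" "x = v s" "v s = v t"
      by (auto simp: setA setB)
    then have "s mod n = t mod n" using v_eq by simp
    then show "x \<in> {v 0, v j}" using st j by (cases "t = n") auto
  qed
  have dA': "set A' \<inter> set B' = {}"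
  proof -
    have False if "s < j" "j \<le> t" "t < n" "d s = d t" for s t
      using that d_eq[of s t] by auto
    then show ?thesis using setA(2) setB' by fastforce
  qed
  have dV: "set A \<inter> set vs \<subseteq> {v 0, v j}" "set B \<inter> set vs \<subseteq> {v 0, v j}"
    using vs_off setA setB by auto
  have dE: "set A' \<inter> set es = {}" "set B' \<inter> set es = {}"
  proof -
    have "set A' \<subseteq> range d" "set B' \<subseteq> range d" using setA(2) setB' by auto
    then show "set A' \<inter> set es = {}" "set B' \<inter> set es = {}"
      using edges_off unfolding ran(2) by blast+
  qed
  have lens: "length A' = j" "length B' = n - j" by (simp_all add: A'_def B'_def)
  have small: "l = 1" if "odd l" "\<not> 3 \<le> l" for l :: nat
    using that by presburger
  \<comment> \<open>The parity of \<open>j\<close> decides which arc is even.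
    \<open>odd_theta_not_odd_free\<close> is then used twice, with the ear and with the odd arc in
    the role of the long odd path.\<close>
  have "length es < 3 \<and> (j = 1 \<or> n - j = 1)"
  proof (cases "even j")
    case True
    then have B: "odd (length B')" and A: "even (length A')" "A' \<noteq> []"
      using n j j0 lens by auto
    have "\<not> 3 \<le> length es"
      using odd_theta_not_odd_free[OF pA pB path(1) hdAB hd_vs lastAB last_vs A B path(2)]
        dA dA' dV dE free by blast
    moreover have "\<not> 3 \<le> length B'"
      using odd_theta_not_odd_free[OF pA path(1) pB hdAB(1) hd_vs hdAB(2) lastAB(1) last_vs lastAB(2)
          A path(2) B] dA dA' dV dE free by (simp add: Int_commute) blast
    ultimately show ?thesis using small[OF B] lens by simp
  next
    case False
    then have A: "odd (length A')" and B: "even (length B')" "B' \<noteq> []"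
      using n j j0 lens by auto
    have "\<not> 3 \<le> length es"
      using odd_theta_not_odd_free[OF pB pA path(1) hdAB(2,1) hd_vs lastAB(2,1) last_vs B A path(2)]
        dA dA' dV dE free by (simp add: Int_commute) blast
    moreover have "\<not> 3 \<le> length A'"
      using odd_theta_not_odd_free[OF pB path(1) pA hdAB(2) hd_vs hdAB(1) lastAB(2) last_vs lastAB(1)
          B path(2) A] dA dA' dV dE free by (simp add: Int_commute) blast
    ultimately show ?thesis using small[OF A] lens by simp
  qed
  moreover have "length es = 1"
    using calculation small[OF path(2)] by simp
  moreover have "ends G (es ! 0) = {v 0, v j}"
    using path(1) \<open>length es = 1\<close> vs0 j(2) by (auto simp: is_path_def)
  \<comment> \<open>If the backward arc is the single edge, then \<open>j = n - 1\<close> and the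
    index wraps around at \<open>v n\<close>.\<close>
  moreover have "{v 0, v j} = {v (n - 1), v (Suc (n - 1))}" if "n - j = 1"
  proof -
    have "n - 1 = j" "Suc (n - 1) = n" using that j by auto
    then show ?thesis using v_n by (simp add: insert_commute)
  qed
  ultimately have "\<exists>i. ends G (es ! 0) = {v i, v (Suc i)}"
    by (metis One_nat_def)
  then show ?thesis using \<open>length es = 1\<close> by (auto simp: v_def)
qed

section \<open>Alternating odd cycles\<close>

lemma is_path_slice:
  assumes "is_path G vs es" "s + j \<le> length es"
  shows "is_path G (take (Suc j) (drop s vs)) (take j (drop s es))"
  unfolding is_path_def
proof (intro conjI allI impI)
  have "set (take (Suc j) (drop s vs)) \<subseteq> set vs" "set (take j (drop s es)) \<subseteq> set es"
    by (meson set_take_subset set_drop_subset subset_trans)+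
  then show "set (take (Suc j) (drop s vs)) \<subseteq> verts G" "set (take j (drop s es)) \<subseteq> edges G"
    using assms(1) by (auto simp: is_path_def)
qed (use assms in \<open>auto simp: is_path_def\<close>)

text \<open>An edge off the cycle with both ends on it is an odd ear of length 1.\<close>

lemma (in multigraph) chord_of_odd_cycle:
  assumes "odd_free C5_plus G" and cyc: "odd_cycle G n u c"
    and d: "d \<in> edges G" "ends G d \<subseteq> range u"
  shows "\<exists>l. ends G d = {u l, u (Suc l)}"
proof (cases "d \<in> range c")
  case True
  then show ?thesis using cyc by (auto simp: odd_cycle_def)
next
  case False
  have "card (ends G d) = 2" using d(1) card_ends by auto
  then obtain x y where xy: "ends G d = {x, y}" "x \<noteq> y" by (auto simp: card_2_iff)
  then have "is_path G [x, y] [d]"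
    using d(1) ends_subset[of d] by (auto simp: is_path_def)
  from odd_ear_of_odd_cycle[OF assms(1) cyc this] show ?thesis
    using xy d(2) False by auto
qed

text \<open>The vertex is written \<open>u (Suc m)\<close> so that its predecessor on the cycle has
  an index too.\<close>

lemma (in multigraph) chord_at_vertex:
  assumes "odd_free C5_plus G" and cyc: "odd_cycle G n u c"
    and d: "d \<in> edges G" "ends G d \<subseteq> range u" "u (Suc m) \<in> ends G d"
  shows "ends G d = {u m, u (Suc m)} \<or> ends G d = {u (Suc m), u (Suc (Suc m))}"
proof -
  note eq = odd_cycle_vertex_eq_iff[OF cyc]
  obtain l where l: "ends G d = {u l, u (Suc l)}"
    using chord_of_odd_cycle[OF assms(1) cyc d(1,2)] by blast
  then consider "u (Suc m) = u l" | "u (Suc m) = u (Suc l)" using d(3) by auto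
  then show ?thesis
  proof cases
    case 1
    then have "u (Suc (Suc m)) = u (Suc l)" by (simp add: eq Suc_mod_eq_iff del: mod_Suc)
    then show ?thesis using l 1 by simp
  next
    case 2
    then have "u m = u l" by (simp add: eq Suc_mod_eq_iff)
    then show ?thesis using l 2 by simp
  qed
qed

text \<open>A chain that leaves the odd cycle and comes back would contain an odd ear, because the last
  edge of the ear cannot have colour \<open>b\<close>.\<close>

lemma (in multigraph) alternating_path_never_returns:
  assumes free: "odd_free C5_plus G" and cyc: "odd_cycle G n u c"
    and alt: "alternating G D \<phi> a b vs es"
    and b_in: "\<And>d. d \<in> D \<Longrightarrow> \<phi> d = b \<Longrightarrow> ends G d \<inter> range u \<noteq> {} \<Longrightarrow> ends G d \<subseteq> range u"
    and s: "even s" "vs ! s \<in> range u" "Suc s \<le> length es \<Longrightarrow> vs ! Suc s \<notin> range u"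
    and i: "s < i" "i \<le> length es"
  shows "vs ! i \<notin> range u"
proof
  assume "vs ! i \<in> range u"
  define P where "P i \<longleftrightarrow> s < i \<and> i \<le> length es \<and> vs ! i \<in> range u" for i
  \<comment> \<open>The first return to the cycle after position \<open>s\<close>; the path from
    \<open>s\<close> to \<open>r\<close> is the candidate for an ear.\<close>
  define r where "r = (LEAST i. P i)"
  have "P i" using i \<open>vs ! i \<in> range u\<close> by (simp add: P_def)
  then have "P r" unfolding r_def by (rule LeastI)
  then have r: "s < r" "r \<le> length es" "vs ! r \<in> range u" by (auto simp: P_def)
  have off: "vs ! t \<notin> range u" if "s < t" "t < r" for t
    using not_less_Least[of t P] that r(2) unfolding r_def[symmetric] by (auto simp: P_def)
  have path: "is_path G vs es" "\<And>t. t < length es \<Longrightarrow> ends G (es ! t) = {vs ! t, vs ! Suc t}"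
    "\<And>t. t < length es \<Longrightarrow> es ! t \<in> D \<and> \<phi> (es ! t) = (if even t then a else b)" "length vs = Suc (length es)"
    using alt by (auto simp: alternating_def is_path_def)
  have "r \<noteq> Suc s" using s(3) r by auto
  then have r2: "Suc s < r" using r(1) by simp
  define j where "j = r - s"
  have j: "2 \<le> j" "s + j = r" "j \<le> length es - s" using r2 r(2) by (auto simp: j_def)
  \<comment> \<open>For even \<open>r\<close> the edge before the return has colour
    \<open>b\<close>, so by \<open>b_in\<close> both its ends lie on the cycle, against the choice
    of \<open>r\<close>.\<close>
  have "odd r"
  proof
    assume "even r"
    then have "odd (r - 1)" using r2 by simp
    moreover have ed: "ends G (es ! (r - 1)) = {vs ! (r - 1), vs ! r}"
      using path(2)[of "r - 1"] r2 r(2) by simp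
    ultimately have "ends G (es ! (r - 1)) \<subseteq> range u"
      using r r2 path(3)[of "r - 1"] by (intro b_in) auto
    then show False using ed off[of "r - 1"] r2 by auto
  qed
  then have "odd j" using s(1) j(2) by auto
  let ?vs = "take (Suc j) (drop s vs)" and ?es = "take j (drop s es)"
  have nth: "?vs ! t = vs ! (s + t)" if "t \<le> j" for t
    using that j r(2) path(4) by simp
  have len: "length ?es = j" using j r(2) by simp
  have "set ?es \<inter> range c = {}"
  proof -
    have False if "t < j" "?es ! t \<in> range c" for t
    proof -
      have "ends G (es ! (s + t)) = {vs ! (s + t), vs ! Suc (s + t)}"
        using path(2)[of "s + t"] that(1) j r(2) by simp
      moreover have "ends G (es ! (s + t)) \<subseteq> range u"
        using that j r(2) cyc by (auto simp: odd_cycle_def)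
      ultimately show False
        using off[of "s + t"] off[of "Suc (s + t)"] that(1) j by (cases "t = 0") auto
    qed
    then show ?thesis using len by (metis disjoint_iff in_set_conv_nth)
  qed
  then have "length ?es = 1"
    using odd_ear_of_odd_cycle[OF free cyc is_path_slice[OF path(1)], of s j]
      nth[of 0] nth[of j] s(2) r nth off j \<open>odd j\<close> len by simp
  \<comment> \<open>The ear would have length 1, but the path left the cycle at
    \<open>Suc s\<close>, so its length is at least 2.\<close>
  then show False using len j(1) by simp
qed

text \<open>An edge of colour \<open>a\<close> at \<open>w\<close> that leaves \<open>U\<close> does
  not count, so a vertex at which \<open>a\<close> is present may be uncovered.\<close>

definition covered :: "('v, 'e) mgraph \<Rightarrow> 'e set \<Rightarrow> ('e \<Rightarrow> nat) \<Rightarrow> nat \<Rightarrow> 'v set \<Rightarrow> 'v \<Rightarrow> bool" where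
  "covered G D \<phi> a U w \<longleftrightarrow> (\<exists>d\<in>D. \<phi> d = a \<and> w \<in> ends G d \<and> ends G d \<subseteq> U)"

text \<open>A Kempe chain closed up by the uncoloured edge \<open>c 0\<close> between
  \<open>u 0\<close> and \<open>u 1\<close>. As \<open>n\<close> is odd, \<open>c 1\<close> has
  colour \<open>b\<close> at \<open>u 1\<close> and \<open>c (n - 1)\<close> has colour
  \<open>a\<close> at \<open>u 0\<close>, in accordance with the missing colours.\<close>

definition alternating_cycle ::
  "('v, 'e) mgraph \<Rightarrow> nat \<Rightarrow> (nat \<Rightarrow> 'v) \<Rightarrow> (nat \<Rightarrow> 'e) \<Rightarrow> nat \<Rightarrow> ('e \<Rightarrow> nat) \<Rightarrow> nat \<Rightarrow> nat \<Rightarrow> bool"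
where
  "alternating_cycle G n u c k \<phi> a b \<longleftrightarrow> odd_cycle G n u c \<and>
    colouring G k (edges G - {c 0}) \<phi> \<and> a < k \<and> b < k \<and> a \<noteq> b \<and>
    (\<forall>i. 1 \<le> i \<longrightarrow> i < n \<longrightarrow> \<phi> (c i) = (if odd i then b else a)) \<and>
    missing G (edges G - {c 0}) \<phi> (u 0) b \<and> missing G (edges G - {c 0}) \<phi> (u 1) a"

text \<open>At \<open>u 0\<close> and \<open>u 1\<close> one of the two colours is missing and the
  other lies on the cycle; at every other vertex of the cycle both lie on it. Properness excludes
  further edges of these colours.\<close>

lemma alternating_cycle_edge_in_cycle:
  assumes ac: "alternating_cycle G n u c k \<phi> a b"
    and d: "d \<in> edges G - {c 0}" "\<phi> d \<in> {a, b}" "ends G d \<inter> range u \<noteq> {}"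
  shows "d \<in> range c"
proof -
  have cyc: "odd_cycle G n u c" and col: "colouring G k (edges G - {c 0}) \<phi>"
    and along: "\<And>i. 1 \<le> i \<Longrightarrow> i < n \<Longrightarrow> \<phi> (c i) = (if odd i then b else a)"
    and miss: "missing G (edges G - {c 0}) \<phi> (u 0) b" "missing G (edges G - {c 0}) \<phi> (u 1) a"
    using ac by (auto simp: alternating_cycle_def)
  have n: "odd n" "3 \<le> n" and c: "\<And>i. c i \<in> edges G" "\<And>i. ends G (c i) = {u i, u (Suc i)}"
    using cyc by (auto simp: odd_cycle_def)
  obtain m where m: "m < n" "u m \<in> ends G d"
    using d(3) odd_cycle_range_eq(1)[OF cyc] by auto
  have cD: "c i \<in> edges G - {c 0}" if "1 \<le> i" "i < n" for i
    using that c(1) odd_cycle_edge_eq_iff[OF cyc, of i 0] by auto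
  have found: "d \<in> range c" if "1 \<le> i" "i < n" "\<phi> d = (if odd i then b else a)" "u m \<in> {u i, u (Suc i)}" for i
    using colouring_unique[OF col d(1) cD[OF that(1,2)]] along[OF that(1,2)] that(3,4) m(2) c(2) by auto
  have un: "u n = u 0" using odd_cycle_vertex_eq_iff[OF cyc, of n 0] by simp
  show ?thesis
  proof (cases "m = 0")
    case True
    then have "\<phi> d = a" using miss(1) m(2) d(1,2) by (auto simp: missing_def)
    then show ?thesis using True n un by (intro found[of "n - 1"]) auto
  next
    case False
    show ?thesis
    proof (cases "\<phi> d = (if odd m then b else a)")
      case True
      then show ?thesis using False m(1) by (intro found[of m]) auto
    next
      case neq: False
      then have "\<phi> d = (if odd (m - 1) then b else a)" using d(2) False by (auto split: if_splits)
      moreover have "m \<noteq> 1" using neq miss(2) m(2) d(1,2) by (auto simp: missing_def)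
      ultimately show ?thesis using False m(1) by (intro found[of "m - 1"]) auto
    qed
  qed
qed

text \<open>In the form that \<open>alternating_path_never_returns\<close> requires of its second
  colour.\<close>

lemma alternating_cycle_closed:
  assumes "alternating_cycle G n u c k \<phi> a b"
    and "d \<in> edges G - {c 0}" "\<phi> d \<in> {a, b}" "ends G d \<inter> range u \<noteq> {}"
  shows "ends G d \<subseteq> range u"
proof -
  obtain i where "d = c i" using alternating_cycle_edge_in_cycle[OF assms] by auto
  then show ?thesis using assms(1) by (auto simp: alternating_cycle_def odd_cycle_def)
qed

text \<open>If another vertex \<open>u j\<close>, with \<open>j\<close> least, were uncovered too, then the Kempe chain of the
  colours \<open>g\<close> and \<open>a\<close> from \<open>u 1\<close> follows the cycle to \<open>u j\<close>, where it leaves the cycle for good.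
  After swapping it, the chain of \<open>g\<close> and \<open>b\<close> from \<open>u 0\<close> leaves at once and never meets \<open>u 1\<close>.
  Swapping that one as well, \<open>g\<close> is missing at both ends of the uncoloured edge \<open>c 0\<close>.\<close>

lemma (in multigraph) uncovered_vertex_unique:
  assumes free: "odd_free C5_plus G" and ac: "alternating_cycle G n u c k \<phi> a b"
    and g: "g < k" "g \<notin> {a, b}"
    and crit: "\<not> (\<exists>\<phi>. colouring G k (edges G) \<phi>)"
    and uncov: "\<not> covered G (edges G - {c 0}) \<phi> g (range u) (u 0)"
    and i: "0 < i" "i < n"
  shows "covered G (edges G - {c 0}) \<phi> g (range u) (u i)"
proof (rule ccontr)
  define D where "D = edges G - {c 0}"
  let ?cov = "\<lambda>i. covered G D \<phi> g (range u) (u i)"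
  assume "\<not> covered G (edges G - {c 0}) \<phi> g (range u) (u i)"
  define P where "P j \<longleftrightarrow> 0 < j \<and> j < n \<and> \<not> ?cov j" for j
  define j where "j = (LEAST j. P j)"
  have "P i" using i \<open>\<not> covered G (edges G - {c 0}) \<phi> g (range u) (u i)\<close> by (simp add: P_def D_def)
  then have "P j" unfolding j_def by (rule LeastI)
  then have j: "0 < j" "j < n" "\<not> ?cov j" by (auto simp: P_def)
  have cov: "?cov i" if "0 < i" "i < j" for i
    using not_less_Least[of i P] that j(2) unfolding j_def[symmetric] by (auto simp: P_def)
  have cyc: "odd_cycle G n u c" and col: "colouring G k D \<phi>" and ab: "a < k" "b < k" "a \<noteq> b"
    and along: "\<And>i. 1 \<le> i \<Longrightarrow> i < n \<Longrightarrow> \<phi> (c i) = (if odd i then b else a)"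
    and miss: "missing G D \<phi> (u 0) b" "missing G D \<phi> (u 1) a"
    using ac by (auto simp: alternating_cycle_def D_def)
  have n: "odd n" "3 \<le> n" and c: "\<And>i. c i \<in> edges G" "\<And>i. ends G (c i) = {u i, u (Suc i)}"
    using cyc by (auto simp: odd_cycle_def)
  have D: "D \<subseteq> edges G" by (auto simp: D_def)
  have uv: "u i \<in> verts G" for i using ends_subset[OF c(1)[of i]] c(2) by auto
  have u_inj: "s = t" if "u s = u t" "s < n" "t < n" for s t
    using that odd_cycle_vertex_eq_iff[OF cyc] by simp
  have cD: "c i \<in> D" if "1 \<le> i" "i < n" for i
    using that c(1) odd_cycle_edge_eq_iff[OF cyc, of i 0] by (auto simp: D_def)
  have closed: "ends G d \<subseteq> range u" if "d \<in> D" "\<phi> d \<in> {a, b}" "ends G d \<inter> range u \<noteq> {}" for d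
    using alternating_cycle_closed[OF ac] that unfolding D_def by blast
  have covI: "?cov i" if "d \<in> D" "\<phi> d = g" "ends G d = {u i, w}" "w \<in> range u" for d i w
    using that by (auto simp: covered_def)
  \<comment> \<open>The edges of colour \<open>g\<close> pair \<open>u 1\<close> with
    \<open>u 2\<close>, \<open>u 3\<close> with \<open>u 4\<close>, and so on, since chords are
    parallel to cycle edges. A vertex \<open>u i\<close> with odd \<open>i\<close> cannot be joined
    to its predecessor, which is the uncovered \<open>u 0\<close> or is already paired.\<close>
  have pair: "\<exists>d\<in>D. \<phi> d = g \<and> ends G d = {u i, u (Suc i)}" if "i < j" "odd i" for i
    using that
  proof (induction i rule: less_induct)
    case (less i)
    obtain m where m: "i = Suc m" using less.prems(2) by (cases i) auto
    obtain d where d: "d \<in> D" "\<phi> d = g" "u i \<in> ends G d" "ends G d \<subseteq> range u"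
      using cov[of i] less.prems by (auto simp: covered_def odd_pos)
    have "ends G d \<noteq> {u m, u (Suc m)}"
    proof
      assume ed: "ends G d = {u m, u (Suc m)}"
      show False
      proof (cases m)
        case 0
        then show False using covI[of d 0 "u 1"] d ed uncov by (simp add: D_def)
      next
        case (Suc l)
        then obtain d' where d': "d' \<in> D" "\<phi> d' = g" "ends G d' = {u l, u m}"
          using less.IH[of l] less.prems m by auto
        then have "d = d'" using colouring_unique[OF col d(1), of d' "u m"] d ed by auto
        then have "u (Suc m) \<in> {u l, u m}" using ed d' by blast
        then show False
          using u_inj[of "Suc m" l] u_inj[of "Suc m" m] Suc m less.prems j(2) by auto
      qed
    qed
    then have "ends G d = {u i, u (Suc i)}"
      using chord_at_vertex[OF free cyc, of d m] d D m by auto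
    then show ?case using d by blast
  qed
  have "odd j"
  proof
    assume "even j"
    then have "odd (j - 1)" "j - 1 < j" "Suc (j - 1) = j" using j(1) by auto
    then obtain d where "d \<in> D" "\<phi> d = g" "ends G d = {u (j - 1), u j}"
      using pair[of "j - 1"] by auto
    then have "?cov j" using covI[of d j "u (j - 1)"] by (auto simp: insert_commute)
    then show False using j(3) by simp
  qed
  obtain vs es where chain: "kempe_chain G D \<phi> g a vs es" "vs ! 0 = u 1"
    using kempe_chain_exists[OF D col uv[of 1] miss(2)] by blast
  have path: "\<And>t. t < length es \<Longrightarrow> ends G (es ! t) = {vs ! t, vs ! Suc t}"
    "\<And>t. t < length es \<Longrightarrow> es ! t \<in> D" "\<And>t. t < length es \<Longrightarrow> \<phi> (es ! t) = (if even t then g else a)"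
    "length vs = Suc (length es)" and alt: "alternating G D \<phi> g a vs es"
    using chain(1) by (auto simp: kempe_chain_def alternating_def is_path_def)
  \<comment> \<open>The edges of colour \<open>g\<close> come from \<open>pair\<close>, those of
    colour \<open>a\<close> are the \<open>c i\<close> with even positive \<open>i\<close>. The
    index is shifted by one because the chain starts at \<open>u 1\<close>.\<close>
  have follow: "vs ! t = u (Suc t)" if "t \<le> length es" "t < j" for t
    using that
  proof (induction t)
    case 0
    then show ?case using chain(2) by simp
  next
    case (Suc t)
    then have vt: "vs ! t = u (Suc t)" by simp
    have t: "t < length es" "Suc t < j" using Suc.prems by auto
    obtain d where d: "d \<in> D" "\<phi> d = (if even t then g else a)"
      "ends G d = {u (Suc t), u (Suc (Suc t))}"
    proof (cases "even t")
      case True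
      then show ?thesis using pair[of "Suc t"] t that by auto
    next
      case False
      then show ?thesis
        using that[of "c (Suc t)"] cD[of "Suc t"] along[of "Suc t"] c(2) t j(2) by auto
    qed
    have "es ! t = d"
      using colouring_unique[OF col path(2)[OF t(1)] d(1), of "vs ! t"] path(1,3)[OF t(1)] d vt by auto
    then have "{u (Suc t), vs ! Suc t} = {u (Suc t), u (Suc (Suc t))}"
      using path(1)[OF t(1)] vt d(3) by simp
    then show ?case by (auto simp: doubleton_eq_iff)
  qed
  \<comment> \<open>The chain reaches \<open>u j\<close> at the even position \<open>j - 1\<close>,
    so a next edge would have colour \<open>g\<close>; as \<open>u j\<close> is uncovered, it leaves
    the cycle.\<close>
  have leave: "vs ! t \<notin> range u" if "t \<le> length es" "j \<le> t" for t
  proof (rule alternating_path_never_returns[OF free cyc alt, of "j - 1"])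
    have j1: "vs ! (j - 1) = u j" using follow[of "j - 1"] that j(1) by simp
    then show "vs ! (j - 1) \<in> range u" by simp
    show "vs ! Suc (j - 1) \<notin> range u"
      using covI[of "es ! (j - 1)" j "vs ! j"] path(1-3)[of "j - 1"] j j1 \<open>odd j\<close> that by auto
  qed (use that j \<open>odd j\<close> closed in auto)
  have u0: "u 0 \<notin> set vs"
  proof
    assume "u 0 \<in> set vs"
    then obtain t where t: "t \<le> length es" "vs ! t = u 0"
      using path(4) by (auto simp: in_set_conv_nth less_Suc_eq_le)
    show False
    proof (cases "t < j")
      case True
      then show False using follow[OF t(1)] t(2) u_inj[of "Suc t" 0] j(2) by simp
    next
      case False
      then show False using leave[OF t(1)] t(2) by auto
    qed
  qed
  define \<phi>1 where "\<phi>1 = swap_colours g a (set es) \<phi>"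
  note swap1 = kempe_chain_swap[OF chain(1) col _ g(1) ab(1), folded \<phi>1_def]
  have col1: "colouring G k D \<phi>1" and miss1: "missing G D \<phi>1 (u 1) g" "missing G D \<phi>1 (u 0) b"
    using swap1(1,2) swap1(4)[OF _ _ miss(1)] chain(2) g ab by auto
  obtain vs' es' where chain': "kempe_chain G D \<phi>1 g b vs' es'" "vs' ! 0 = u 0"
    using kempe_chain_exists[OF D col1 uv miss1(2)] by blast
  have path': "\<And>t. t < length es' \<Longrightarrow> ends G (es' ! t) = {vs' ! t, vs' ! Suc t}"
    "\<And>t. t < length es' \<Longrightarrow> es' ! t \<in> D" "\<And>t. t < length es' \<Longrightarrow> \<phi>1 (es' ! t) = (if even t then g else b)"
    "length vs' = Suc (length es')" and alt': "alternating G D \<phi>1 g b vs' es'"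
    using chain'(1) by (auto simp: kempe_chain_def alternating_def is_path_def)
  have leave': "vs' ! t \<notin> range u" if "t \<le> length es'" "0 < t" for t
  proof (rule alternating_path_never_returns[OF free cyc alt', of 0])
    \<comment> \<open>The first swap leaves colour \<open>b\<close> alone, so edges of colour
      \<open>b\<close> still stay within the cycle.\<close>
    fix d assume d: "d \<in> D" "\<phi>1 d = b" "ends G d \<inter> range u \<noteq> {}"
    then have "\<phi> d = b" using g ab by (auto simp: \<phi>1_def swap_colours_def split: if_splits)
    then show "ends G d \<subseteq> range u" using closed d by auto
  next
    assume "Suc 0 \<le> length es'"
    then have "es' \<noteq> []" by auto
    then have e: "ends G (es' ! 0) = {u 0, vs' ! 1}" "es' ! 0 \<in> D" "\<phi>1 (es' ! 0) = g"
      using path'(1-3)[of 0] chain'(2) by auto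
    \<comment> \<open>The vertex \<open>u 0\<close> is not on the first chain, so this edge had
      colour \<open>g\<close> before the swap, and the choice of \<open>u 0\<close> as uncovered
      applies.\<close>
    then have "es' ! 0 \<notin> set es" using kempe_chain_edges(3)[OF chain(1), of "es' ! 0"] u0 by auto
    then have "\<phi> (es' ! 0) = g" using e(3) by (simp add: \<phi>1_def swap_colours_def)
    then show "vs' ! Suc 0 \<notin> range u" using covI[of "es' ! 0" 0 "vs' ! 1"] e uncov by (auto simp: D_def)
  qed (use that chain'(2) in auto)
  have u1: "u 1 \<notin> set vs'"
  proof
    assume "u 1 \<in> set vs'"
    then obtain t where t: "t \<le> length es'" "vs' ! t = u 1"
      using path'(4) by (auto simp: in_set_conv_nth less_Suc_eq_le)
    then show False using leave'[OF t(1)] chain'(2) u_inj[of 0 1] n(2) by (cases "t = 0") auto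
  qed
  define \<phi>2 where "\<phi>2 = swap_colours g b (set es') \<phi>1"
  note swap2 = kempe_chain_swap[OF chain'(1) col1 _ g(1) ab(2), folded \<phi>2_def]
  have col2: "colouring G k D \<phi>2" and miss2: "missing G D \<phi>2 (u 0) g" "missing G D \<phi>2 (u 1) g"
    using swap2(1,2) swap2(3)[OF _ u1 miss1(1)] chain'(2) g ab by auto
  have "colouring G k (insert (c 0) D) (\<phi>2(c 0 := g))"
    using miss2 c(2)[of 0] by (intro colouring_insert[OF col2 g(1)]) auto
  moreover have "insert (c 0) D = edges G" using c(1) by (auto simp: D_def)
  ultimately show False using crit by auto
qed

text \<open>Allows any edge of the cycle to become the uncoloured one: the others are coloured
  alternately anew, starting after \<open>c 0\<close>.\<close>

lemma recolour_cycle: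
  assumes cyc: "odd_cycle G n u c" and col: "colouring G k (edges G - range c) \<psi>"
    and ab: "a < k" "b < k" "a \<noteq> b"
    and miss: "\<And>i. missing G (edges G - range c) \<psi> (u i) a" "\<And>i. missing G (edges G - range c) \<psi> (u i) b"
  obtains \<phi> where "alternating_cycle G n u c k \<phi> a b" "\<And>d. d \<notin> range c \<Longrightarrow> \<phi> d = \<psi> d"
    "\<And>d. d \<in> range c \<Longrightarrow> \<phi> d \<in> {a, b}"
proof -
  have n: "odd n" "3 \<le> n" and c: "\<And>i. c i \<in> edges G" "\<And>i. ends G (c i) = {u i, u (Suc i)}"
    using cyc by (auto simp: odd_cycle_def)
  note u_eq = odd_cycle_vertex_eq_iff[OF cyc] and c_eq = odd_cycle_edge_eq_iff[OF cyc]
  \<comment> \<open>The inverse image is the index below \<open>n\<close> of a cycle edge. The edge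
    \<open>c 0\<close> gets the default \<open>a\<close>, but does not belong to the coloured set
    \<open>D\<close>.\<close>
  define \<phi> where "\<phi> d = (if d \<in> range c then if odd (inv_into {..<n} c d) then b else a else \<psi> d)" for d
  have "inj_on c {..<n}" by (auto simp: inj_on_def c_eq)
  then have on: "\<phi> (c i) = (if odd i then b else a)" if "i < n" for i
    using that by (simp add: \<phi>_def inv_into_f_f)
  have off: "\<phi> d = \<psi> d" if "d \<notin> range c" for d
    using that by (simp add: \<phi>_def)
  have ab_on: "\<phi> d \<in> {a, b}" if "d \<in> range c" for d
    using that by (simp add: \<phi>_def)
  define D where "D = edges G - {c 0}"
  have inD: "\<exists>i. 1 \<le> i \<and> i < n \<and> d = c i" if d: "d \<in> D" "d \<in> range c" for d
  proof -
    obtain i where "i < n" "d = c i" using d(2) odd_cycle_range_eq(2)[OF cyc] by auto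
    moreover from this have "i \<noteq> 0" using d(1) by (intro notI) (simp add: D_def)
    ultimately show ?thesis by (intro exI[of _ i]) simp
  qed
  have mixed: False if de: "d \<in> range c" "e \<in> D" "e \<notin> range c" "\<phi> d = \<phi> e"
    "ends G d \<inter> ends G e \<noteq> {}" for d e
  proof -
    obtain i where "u i \<in> ends G e" using de(1,5) c(2) by auto
    moreover have "\<psi> e \<in> {a, b}" using ab_on[OF de(1)] off[OF de(3)] de(4) by simp
    moreover have "e \<in> edges G - range c" using de(2,3) by (simp add: D_def)
    ultimately show False using miss[of i] unfolding missing_def by blast
  qed
  have "colouring G k D \<phi>"
    unfolding colouring_def
  proof (intro conjI ballI impI)
    fix d assume "d \<in> D"
    then show "\<phi> d < k"
      using ab_on[of d] off[of d] ab col by (cases "d \<in> range c") (auto simp: colouring_def D_def)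
  next
    fix d e assume *: "d \<in> D" "e \<in> D" "\<phi> d = \<phi> e" "ends G d \<inter> ends G e \<noteq> {}"
    consider "d \<in> range c" "e \<in> range c" | "d \<notin> range c" "e \<notin> range c"
      using mixed[of d e] mixed[of e d] * by (metis Int_commute)
    then show "d = e"
    proof cases
      case 1
      obtain s where s: "1 \<le> s" "s < n" "d = c s" using inD[OF *(1) 1(1)] by auto
      obtain t where t: "1 \<le> t" "t < n" "e = c t" using inD[OF *(2) 1(2)] by auto
      have par: "odd s = odd t" using *(3) on s t ab(3) by (auto split: if_splits)
      \<comment> \<open>Indices run from 1 to \<open>n\<close>, as the far end of the last cycle
        edge is \<open>u n\<close>. Thus edges that meet have indices differing by at most 1, and
        equal parity makes them equal.\<close>
      have eq: "i = j" if "u i = u j" "1 \<le> i" "1 \<le> j" "i \<le> n" "j \<le> n" for i j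
      proof -
        have "i mod n = j mod n" using that(1) u_eq by simp
        then show ?thesis using that n(2) by (cases "i = n"; cases "j = n") auto
      qed
      have "{u s, u (Suc s)} \<inter> {u t, u (Suc t)} \<noteq> {}" using *(4) unfolding s(3) t(3) c(2) .
      then have "u s = u t \<or> u s = u (Suc t) \<or> u (Suc s) = u t \<or> u (Suc s) = u (Suc t)"
        by blast
      then have "s = t \<or> s = Suc t \<or> Suc s = t"
      proof (elim disjE)
        assume "u s = u t"
        from eq[OF this] show ?thesis using s t by simp
      next
        assume "u s = u (Suc t)"
        from eq[OF this] show ?thesis using s t by simp
      next
        assume "u (Suc s) = u t"
        from eq[OF this] show ?thesis using s t by simp
      next
        assume "u (Suc s) = u (Suc t)"
        from eq[OF this] show ?thesis using s t by simp
      qed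
      then show ?thesis using par s t by auto
    next
      case 2
      moreover have "d \<in> edges G - range c" "e \<in> edges G - range c" using 2 *(1,2) unfolding D_def by blast+
      moreover have "\<psi> d = \<psi> e" using 2 *(3) off by metis
      ultimately show ?thesis using *(4) col unfolding colouring_def by blast
    qed
  qed
  moreover have "missing G D \<phi> (u 0) b" "missing G D \<phi> (u 1) a"
  proof -
    have off': "\<phi> d \<notin> {a, b}" if "d \<in> D" "d \<notin> range c" "u i \<in> ends G d" for d i
      using that miss[of i] off[of d] unfolding missing_def D_def by auto
    show "missing G D \<phi> (u 0) b"
      unfolding missing_def
    proof (intro ballI impI)
      fix d assume d: "d \<in> D" "u 0 \<in> ends G d"
      show "\<phi> d \<noteq> b"
      proof (cases "d \<in> range c")
        case True
        obtain s where s: "1 \<le> s" "s < n" "d = c s" using inD[OF d(1) True] by auto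
        then have "u 0 = u s \<or> u 0 = u (Suc s)" using d(2) c(2) by simp
        then have "s mod n = 0 \<or> Suc s mod n = 0" unfolding u_eq by auto
        \<comment> \<open>Apart from \<open>c 0\<close>, only \<open>c (n - 1)\<close> meets
          \<open>u 0\<close>, and \<open>n - 1\<close> is even.\<close>
        then have "\<not> Suc s < n" using s(1,2) mod_less[of s n] mod_less[of "Suc s" n] by linarith
        then have "Suc s = n" using s(2) by simp
        then show ?thesis using on[of s] s n(1) ab(3) by auto
      qed (use off'[OF d(1) _ d(2)] in auto)
    qed
    show "missing G D \<phi> (u 1) a"
      unfolding missing_def
    proof (intro ballI impI)
      fix d assume d: "d \<in> D" "u 1 \<in> ends G d"
      show "\<phi> d \<noteq> a"
      proof (cases "d \<in> range c")
        case True
        obtain s where s: "1 \<le> s" "s < n" "d = c s" using inD[OF d(1) True] by auto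
        then have "u 1 = u s \<or> u (Suc 0) = u (Suc s)" using d(2) c(2) by simp
        then have "1 mod n = s mod n \<or> Suc 0 mod n = Suc s mod n" unfolding u_eq .
        then have "s = 1" using s n(2) Suc_mod_eq_iff[of 0 n s] by auto
        then show ?thesis using on[of s] s ab(3) by auto
      qed (use off'[OF d(1) _ d(2)] in auto)
    qed
  qed
  ultimately have "alternating_cycle G n u c k \<phi> a b"
    using cyc ab on unfolding alternating_cycle_def D_def by blast
  then show ?thesis using that off ab_on by blast
qed

text \<open>Rotating and recolouring the cycle moves any given uncovered vertex to position 0, where
  \<open>uncovered_vertex_unique\<close> applies.\<close>

lemma (in multigraph) card_uncovered_le_1:
  assumes free: "odd_free C5_plus G" and ac: "alternating_cycle G n u c k \<phi> a b"
    and g: "g < k" "g \<notin> {a, b}"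
    and crit: "\<not> (\<exists>\<phi>. colouring G k (edges G) \<phi>)"
  shows "card {w \<in> range u. \<not> covered G (edges G - range c) \<phi> g (range u) w} \<le> 1"
proof -
  define D where "D = edges G - range c"
  have cyc: "odd_cycle G n u c" and col: "colouring G k (edges G - {c 0}) \<phi>"
    and ab: "a < k" "b < k" "a \<noteq> b" using ac by (auto simp: alternating_cycle_def)
  have colD: "colouring G k D \<phi>" using col unfolding colouring_def D_def by blast
  have "\<phi> d \<notin> {a, b}" if "d \<in> D" "u i \<in> ends G d" for d i
    using alternating_cycle_edge_in_cycle[OF ac, of d] that unfolding D_def by blast
  then have miss: "missing G D \<phi> (u i) a" "missing G D \<phi> (u i) b" for i
    unfolding missing_def by blast+
  have fin: "finite (range u)" using odd_cycle_range_eq(1)[OF cyc] by simp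
  have "covered G D \<phi> g (range u) w" if w: "v \<in> range u" "\<not> covered G D \<phi> g (range u) v"
    "w \<in> range u" "w \<noteq> v" for v w
  proof -
    obtain p where p: "v = u p" using w(1) by auto
    define u' where "u' = (\<lambda>i. u (i + p))"
    define c' where "c' = (\<lambda>i. c (i + p))"
    have cyc': "odd_cycle G n u' c'" unfolding u'_def c'_def by (rule odd_cycle_shift[OF cyc])
    have ran: "range u' = range u" "range c' = range c"
      unfolding u'_def c'_def by (rule odd_cycle_range_shift[OF cyc])+
    obtain \<phi>' where ac': "alternating_cycle G n u' c' k \<phi>' a b"
      and off: "\<And>d. d \<notin> range c' \<Longrightarrow> \<phi>' d = \<phi> d" and on: "\<And>d. d \<in> range c' \<Longrightarrow> \<phi>' d \<in> {a, b}"
    proof (rule recolour_cycle[OF cyc' _ ab])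
      show "colouring G k (edges G - range c') \<phi>" using colD ran by (simp add: D_def)
      show "missing G (edges G - range c') \<phi> (u' i) a" "missing G (edges G - range c') \<phi> (u' i) b" for i
        using miss ran by (simp_all add: D_def u'_def)
    qed blast
    \<comment> \<open>The recolouring only uses \<open>a\<close> and \<open>b\<close> on the cycle,
      so the edges of colour \<open>g\<close> are the same before and after.\<close>
    have cov: "covered G (edges G - {c' 0}) \<phi>' g (range u') x \<longleftrightarrow> covered G D \<phi> g (range u) x" for x
    proof -
      have "d \<in> edges G - {c' 0} \<and> \<phi>' d = g \<longleftrightarrow> d \<in> D \<and> \<phi> d = g" for d
        using on[of d] off[of d] g(2) ran(2) by (cases "d \<in> range c") (auto simp: D_def)
      then show ?thesis unfolding covered_def ran by blast
    qed
    obtain i where i: "i < n" "w = u' i" using w(3) odd_cycle_range_eq(1)[OF cyc'] ran by auto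
    have "i \<noteq> 0" using w(4) i p by (intro notI) (simp add: u'_def)
    moreover have "\<not> covered G (edges G - {c' 0}) \<phi>' g (range u') (u' 0)"
      using cov w(2) p by (simp add: u'_def)
    ultimately show ?thesis
      using uncovered_vertex_unique[OF free ac' g crit] i cov by auto
  qed
  then show ?thesis
    unfolding D_def[symmetric] by (intro card_le_Suc0_iff_eq[THEN iffD2, folded One_nat_def])
      (use fin in auto)
qed

text \<open>Each of the \<open>k - 2\<close> other colours has at least \<open>(n - 1) / 2\<close>
  edges inside the vertex set of the cycle. Adding the \<open>n\<close> cycle edges, with
  \<open>c 0\<close> among them, exceeds the bound \<open>k * (n - 1) / 2\<close>.\<close>

lemma (in multigraph) colouring_exists_of_alternating_cycle:
  assumes free: "odd_free C5_plus G" and ac: "alternating_cycle G n u c k \<phi> a b"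
    and dens: "2 * card (edges_within G (range u)) \<le> k * (n - 1)"
  shows "\<exists>\<phi>. colouring G k (edges G) \<phi>"
proof (rule ccontr)
  assume crit: "\<not> (\<exists>\<phi>. colouring G k (edges G) \<phi>)"
  have cyc: "odd_cycle G n u c" and ab: "a < k" "b < k" "a \<noteq> b"
    using ac by (auto simp: alternating_cycle_def)
  have n: "3 \<le> n" and c: "\<And>i. c i \<in> edges G" "\<And>i. ends G (c i) = {u i, u (Suc i)}"
    using cyc by (auto simp: odd_cycle_def)
  define D where "D = edges G - range c"
  define U where "U = range u"
  have cardU: "card U = n" "finite U"
    using cyc odd_cycle_range_eq(1)[OF cyc] by (auto simp: odd_cycle_def card_image U_def)
  have cardc: "card (range c) = n" "finite (range c)"
    using odd_cycle_range_eq(2)[OF cyc] odd_cycle_edge_eq_iff[OF cyc]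
    by (auto simp: card_image inj_on_def)
  define N where "N g = {d \<in> D. \<phi> d = g \<and> ends G d \<subseteq> U}" for g
  have finN: "finite (N g)" for g
    by (rule finite_subset[OF _ finite_edges]) (auto simp: N_def D_def)
  have card_N: "n - 1 \<le> 2 * card (N g)" if "g \<in> {..<k} - {a, b}" for g
  proof -
    let ?F = "{w \<in> U. \<not> covered G D \<phi> g U w}"
    have F: "card ?F \<le> 1"
      using card_uncovered_le_1[OF free ac _ _ crit, of g] that unfolding D_def U_def by auto
    \<comment> \<open>All but at most one vertex of \<open>U\<close> are ends of edges in
      \<open>N g\<close>, and each edge accounts for two vertices.\<close>
    have "U \<subseteq> ?F \<union> (\<Union>d\<in>N g. ends G d)" by (auto simp: covered_def N_def)
    then have "card U \<le> card (?F \<union> (\<Union>d\<in>N g. ends G d))"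
      using cardU finN finite_ends by (intro card_mono) (auto simp: N_def D_def)
    also have "\<dots> \<le> card ?F + card (\<Union>d\<in>N g. ends G d)" by (rule card_Un_le)
    also have "card (\<Union>d\<in>N g. ends G d) \<le> (\<Sum>d\<in>N g. card (ends G d))"
      by (rule card_UN_le[OF finN])
    also have "\<dots> = (\<Sum>d\<in>N g. 2)" by (rule sum.cong) (auto simp: N_def D_def card_ends)
    finally show ?thesis using F cardU by simp
  qed
  let ?K = "{..<k} - {a, b}"
  have cardK: "card ?K = k - 2" using ab by (simp add: card_Diff_subset)
  have "(k - 2) * (n - 1) = (\<Sum>g\<in>?K. n - 1)" using cardK by simp
  also have "\<dots> \<le> (\<Sum>g\<in>?K. 2 * card (N g))" using card_N by (rule sum_mono)
  also have "\<dots> = 2 * card (\<Union>g\<in>?K. N g)"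
    by (subst card_UN_disjoint) (use finN in \<open>auto simp: N_def sum_distrib_left\<close>)
  finally have 1: "(k - 2) * (n - 1) \<le> 2 * card (\<Union>g\<in>?K. N g)" .
  have "card (range c) + card (\<Union>g\<in>?K. N g) = card (range c \<union> (\<Union>g\<in>?K. N g))"
    using finN cardc by (intro card_Un_disjoint[symmetric]) (auto simp: N_def D_def)
  also have "\<dots> \<le> card (edges_within G U)"
    using c finite_edges by (intro card_mono) (auto simp: edges_within_def N_def D_def U_def)
  finally have "2 * n + (k - 2) * (n - 1) \<le> k * (n - 1)"
    using 1 dens cardc by (simp add: U_def)
  moreover have "k = (k - 2) + 2" using ab by linarith
  then have "k * (n - 1) = (k - 2) * (n - 1) + 2 * (n - 1)" by (metis add_mult_distrib)
  ultimately show False using n by linarith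
qed

section \<open>Colouring the graph edge by edge\<close>

lemma (in multigraph) missing_colour_exists:
  assumes "e \<in> edges G" "v \<in> ends G e" "card {d \<in> edges G. v \<in> ends G d} \<le> k"
  obtains a where "a < k" "missing G (edges G - {e}) \<phi> v a"
proof -
  let ?S = "{d \<in> edges G - {e}. v \<in> ends G d}"
  \<comment> \<open>The uncoloured edge \<open>e\<close> takes up one of the at most
    \<open>k\<close> edges at \<open>v\<close>, so fewer than \<open>k\<close> colours occur
    there.\<close>
  have "card ?S < card {d \<in> edges G. v \<in> ends G d}"
    using assms finite_edges by (intro psubset_card_mono) auto
  then have "card (\<phi> ` ?S) < k"
    using assms(3) card_image_le[of ?S \<phi>] finite_edges by fastforce
  then have "\<not> {..<k} \<subseteq> \<phi> ` ?S"
    using card_mono[of "\<phi> ` ?S" "{..<k}"] finite_edges by auto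
  then show ?thesis using that by (auto simp: missing_def)
qed

lemma (in multigraph) colouring_extend:
  assumes free: "odd_free C5_plus G"
    and deg: "\<And>v. card {d \<in> edges G. v \<in> ends G d} \<le> k"
    and dens: "\<And>U. odd (card U) \<Longrightarrow> 2 * card (edges_within G U) \<le> k * (card U - 1)"
    and e: "e \<in> edges G" and col: "colouring G k (edges G - {e}) \<phi>"
  shows "\<exists>\<phi>. colouring G k (edges G) \<phi>"
proof (rule ccontr)
  assume crit: "\<not> (\<exists>\<phi>. colouring G k (edges G) \<phi>)"
  define D where "D = edges G - {e}"
  have D: "D \<subseteq> edges G" "insert e D = edges G" and col: "colouring G k D \<phi>"
    using e col by (auto simp: D_def)
  have "card (ends G e) = 2" using e card_ends by auto
  then obtain x y where xy: "ends G e = {x, y}" "x \<noteq> y" by (auto simp: card_2_iff)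
  have conflict: False if "a < k" "colouring G k D \<phi>'" "missing G D \<phi>' x a" "missing G D \<phi>' y a" for a \<phi>'
    using colouring_insert[OF that(2,1), of e] that(3,4) xy D(2) crit by auto
  obtain a where a: "a < k" "missing G D \<phi> x a"
    using missing_colour_exists[OF e _ deg] xy unfolding D_def by blast
  obtain b where b: "b < k" "missing G D \<phi> y b"
    using missing_colour_exists[OF e _ deg] xy unfolding D_def by blast
  have ab: "a \<noteq> b" using conflict[OF a(1) col a(2)] b(2) by auto
  have "x \<in> verts G" using ends_subset[OF e] xy by auto
  then obtain vs es where chain: "kempe_chain G D \<phi> b a vs es" "vs ! 0 = x"
    using kempe_chain_exists[OF D(1) col _ a(2)] by blast
  have path: "\<And>t. t < length es \<Longrightarrow> ends G (es ! t) = {vs ! t, vs ! Suc t}"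
    "\<And>t. t < length es \<Longrightarrow> es ! t \<in> D" "\<And>t. t < length es \<Longrightarrow> \<phi> (es ! t) = (if even t then b else a)"
    "length vs = Suc (length es)" "distinct vs"
    using chain(1) by (auto simp: kempe_chain_def alternating_def is_path_def)
  \<comment> \<open>If the chain from \<open>x\<close> avoided \<open>y\<close>, swapping it would
    make \<open>b\<close> missing at both ends of \<open>e\<close>.\<close>
  have "y \<in> set vs"
  proof (rule ccontr)
    assume "y \<notin> set vs"
    then show False
      using kempe_chain_swap[OF chain(1) col ab[symmetric] b(1) a(1)] conflict[OF b(1)] b(2) chain(2)
      by blast
  qed
  then obtain m where m: "m \<le> length es" "vs ! m = y"
    using path(4) by (auto simp: in_set_conv_nth less_Suc_eq_le)
  have "m \<noteq> 0" using m chain(2) xy by (intro notI) auto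
  \<comment> \<open>For odd \<open>m\<close> the chain would enter \<open>y\<close> by an edge of
    colour \<open>b\<close>, which is missing there. So \<open>e\<close> closes the chain to a cycle
    of odd length \<open>Suc m\<close>.\<close>
  have "even m"
  proof (rule ccontr)
    assume "odd m"
    then have "m - 1 < length es" "even (m - 1)" "Suc (m - 1) = m" using m by (cases m; simp)+
    then have "ends G (es ! (m - 1)) = {vs ! (m - 1), y}" "es ! (m - 1) \<in> D" "\<phi> (es ! (m - 1)) = b"
      using path(1-3)[of "m - 1"] m by auto
    then show False using b(2) unfolding missing_def by blast
  qed
  define n where "n = Suc m"
  have n: "odd n" "3 \<le> n" using \<open>even m\<close> \<open>m \<noteq> 0\<close> by (auto simp: n_def elim!: evenE)
  \<comment> \<open>The cycle starts with \<open>u 0 = y\<close>, \<open>u 1 = x\<close> and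
    \<open>c 0 = e\<close>. Since \<open>n = Suc m\<close>, the entry \<open>vs ! m\<close>, which
    is \<open>y\<close> again, is not reached before the index wraps around.\<close>
  define u where "u i = (y # vs) ! (i mod n)" for i
  define c where "c i = (e # es) ! (i mod n)" for i
  have cyc: "odd_cycle G n u c"
    unfolding odd_cycle_def
  proof (intro conjI allI)
    have u_nth: "u s = vs ! (if s = 0 then m else s - 1)" if "s < n" for s
      using that m(2) by (cases s) (auto simp: u_def)
    have "s = t" if "s < n" "t < n" "u s = u t" for s t
    proof -
      have "vs ! (if s = 0 then m else s - 1) = vs ! (if t = 0 then m else t - 1)"
        using that u_nth by simp
      then have "(if s = 0 then m else s - 1) = (if t = 0 then m else t - 1)"
        using that(1,2) m(1) path(4) by (subst (asm) nth_eq_iff_index_eq[OF path(5)]) (auto simp: n_def)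
      then show ?thesis using that(1,2) by (auto simp: n_def split: if_splits)
    qed
    then show "inj_on u {..<n}" by (auto simp: inj_on_def)
    fix i
    show "u (i + n) = u i" "c (i + n) = c i" by (simp_all add: u_def c_def)
    have "i mod n < n" using n by simp
    then have "c i \<in> edges G \<and> ends G (c i) = {u i, u (Suc i)}"
    proof (cases "i mod n")
      case 0
      moreover have "Suc i mod n = 1" using 0 n by (simp add: mod_Suc)
      ultimately show ?thesis using e xy chain(2) by (auto simp: c_def u_def)
    next
      case (Suc t)
      have t: "t < m" using Suc \<open>i mod n < n\<close> by (simp add: n_def)
      have "u (Suc i) = vs ! Suc t"
        using Suc t m(2) by (auto simp: u_def mod_Suc n_def)
      then show ?thesis using Suc path(1,2)[of t] t m(1) D(1) by (auto simp: c_def u_def)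
    qed
    then show "c i \<in> edges G" "ends G (c i) = {u i, u (Suc i)}" by auto
  qed (use n in auto)
  have "alternating_cycle G n u c k \<phi> a b"
    unfolding alternating_cycle_def
  proof (intro conjI allI impI)
    show "\<phi> (c i) = (if odd i then b else a)" if "1 \<le> i" "i < n" for i
      using path(3)[of "i - 1"] that m(1) by (cases i) (auto simp: c_def n_def)
  qed (use cyc a b ab col chain(2) n in \<open>simp_all add: c_def u_def D_def\<close>)
  moreover have "card (range u) = n"
    using odd_cycle_range_eq(1)[OF cyc] cyc by (simp add: odd_cycle_def card_image)
  ultimately show False
    using colouring_exists_of_alternating_cycle[OF free] dens[of "range u"] n crit by simp
qed

text \<open>The number \<open>k\<close> is fixed and all hypotheses pass to subgraphs, so edges can
  be deleted and restored one at a time.\<close>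

lemma colouring_exists:
  fixes G :: "('v, 'e) mgraph"
  assumes "multigraph G" "odd_free C5_plus G"
    and "\<And>v. card {d \<in> edges G. v \<in> ends G d} \<le> k"
    and "\<And>U. odd (card U) \<Longrightarrow> 2 * card (edges_within G U) \<le> k * (card U - 1)"
  shows "\<exists>\<phi>. colouring G k (edges G) \<phi>"
  using assms
proof (induction "card (edges G)" arbitrary: G)
  case 0
  then have "edges G = {}" by (simp add: multigraph.finite_edges)
  then show ?case by (simp add: colouring_def)
next
  case (Suc l)
  interpret multigraph G by fact
  obtain e where e: "e \<in> edges G" using Suc.hyps(2) by (metis card.empty equals0I nat.distinct(1))
  define H where "H = G\<lparr>edges := edges G - {e}\<rparr>"
  have H: "verts H = verts G" "edges H = edges G - {e}" "ends H = ends G" by (simp_all add: H_def)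
  have "\<exists>\<phi>. colouring H k (edges H) \<phi>"
  proof (rule Suc.hyps(1))
    show "l = card (edges H)" using Suc.hyps(2) e by (simp add: H)
    show "multigraph H"
      by standard (use finite_verts finite_edges ends_subset card_ends in \<open>auto simp: H\<close>)
    have "subgraph S G" if "subgraph S H" for S :: "('v, 'e) mgraph"
      using that by (auto simp: subgraph_def H)
    then show "odd_free C5_plus H" using Suc.prems(2) unfolding odd_free_def by blast
    show "card {d \<in> edges H. v \<in> ends H d} \<le> k" for v
      using card_mono[of "{d \<in> edges G. v \<in> ends G d}" "{d \<in> edges H. v \<in> ends H d}"]
        Suc.prems(3)[of v] finite_edges by (force simp: H)
    show "2 * card (edges_within H U) \<le> k * (card U - 1)" if "odd (card U)" for U
      using card_mono[of "edges_within G U" "edges_within H U"] Suc.prems(4)[OF that] finite_edges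
      by (force simp: H edges_within_def)
  qed
  then obtain \<phi> where "colouring G k (edges G - {e}) \<phi>" by (auto simp: colouring_def H)
  then show ?case using colouring_extend Suc.prems e by blast
qed

theorem theorem6:
  fixes H :: "('v, 'e) mgraph"
  assumes "multigraph H"
    and "odd_free C5_plus H"
  shows "int (chromatic_index H) = \<lceil>fractional_chromatic_index H\<rceil>"
proof (rule antisym)
  interpret multigraph H by fact
  let ?cover = "\<lambda>k M. (\<forall>i<k. M i \<in> matchings H) \<and> edges H \<subseteq> (\<Union>i<k. M i)"
  define k where "k = nat \<lceil>fractional_chromatic_index H\<rceil>"
  have k: "int k = \<lceil>fractional_chromatic_index H\<rceil>"
    using fractional_chromatic_index_nonneg by (simp add: k_def)
  have "\<exists>\<phi>. colouring H k (edges H) \<phi>"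
  proof (rule colouring_exists[OF assms])
    show "card {d \<in> edges H. v \<in> ends H d} \<le> k" for v
      using degree_le_ceiling_fractional_chromatic_index[of v] k by simp
    fix U :: "'v set" assume "odd (card U)"
    \<comment> \<open>An odd cardinality is positive, so the truncated subtraction agrees with that
      of the integers.\<close>
    then have "int (card U - 1) = int (card U) - 1" by (simp add: of_nat_diff odd_pos Suc_leI)
    then have "int (2 * card (edges_within H U)) \<le> int (k * (card U - 1))"
      using card_edges_within_le_ceiling_fractional_chromatic_index[OF \<open>odd (card U)\<close>] k
      by (simp only: of_nat_mult of_nat_numeral)
    then show "2 * card (edges_within H U) \<le> k * (card U - 1)" by (simp only: of_nat_le_iff)
  qed
  then obtain \<phi> where \<phi>: "colouring H k (edges H) \<phi>" by blast
  define M where "M i = {d \<in> edges H. \<phi> d = i}" for i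
  have M: "?cover k M" using \<phi> by (auto simp: M_def matchings_def colouring_def)
  then have "chromatic_index H \<le> k" unfolding chromatic_index_def by (intro Least_le) blast
  then show "int (chromatic_index H) \<le> \<lceil>fractional_chromatic_index H\<rceil>" using k by simp
  have "\<exists>M. ?cover (chromatic_index H) M"
    unfolding chromatic_index_def by (rule LeastI_ex) (use M in blast)
  then have "fractional_chromatic_index H \<le> real (chromatic_index H)"
    using fractional_chromatic_index_le by blast
  then show "\<lceil>fractional_chromatic_index H\<rceil> \<le> int (chromatic_index H)" by (simp add: ceiling_le_iff)
qed

end
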